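(* Let $X$ be a rearrangement invariant space on $[0,1]$. The following are equivalent: (i) The continuous embedding $G\subset X$ holds, i.e. there is $C>0$ with $\|f\|_X\le C\|f\|_{L^{M_2}}$ for all $f\in L^\infty$. (ii) For every $q>1$ there exist constants $A(X,q),B(X,q)>0$ such that $A(X,q)(\sum_k a_k^2)^{1/2}\le\|\sum_{k\ge1}a_kw_{n_k}\|_X\le B(X,q)(\sum_ka_k^2)^{1/2}$ for all $(a_k)\in\ell^2$ and every $q$-lacunary sequence $(w_{n_k})$ of Walsh functions. (iii) There exist a sequence $(n_k)_{k\ge1}$ of nonnegative integers and constants $A(X),B(X)>0$ such that $A(X)(\sum_ka_k^2)^{1/2}\le\|\sum_{k\ge1}a_kw_{n_k}\|_X\le B(X)(\sum_ka_k^2)^{1/2}$ for all $(a_k)\in\ell^2$.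
   Context: $m$ is Lebesgue measure. A Banach function space $X$ over $[0,1]$ is a linear space of measurable functions with a complete norm such that $g\in X$, $|f|\le|g|$ a.e. imply $f\in X$, $\|f\|_X\le\|g\|_X$; it is rearrangement invariant (r.i.) if equimeasurable functions have equal norms (and membership). $L^{M_2}$ is the Orlicz space with $M_2(t)=\exp(t^2)-1$ and norm $\|f\|_{L^{M_2}}=\inf\{\lambda>0:\int_0^1M_2(|f|/\lambda)dm\le1\}$; $G$ is the closure of $L^\infty$ in $L^{M_2}$. Rademacher functions $r_k(t)=\mathrm{sign}\sin(2^k\pi t)$; Walsh functions (Paley numbering) $w_0=1$, $w_k=r_1^{a_1}\cdots r_n^{a_n}$ for $k=\sum_{i=1}^na_i2^{i-1}$, $a_i\in\{0,1\}$. $(w_{n_k})$ is $q$-lacunary if $n_{k+1}/n_k\ge q>1$ for all $k$. The series $\sum a_kw_{n_k}$ is understood as its $L^2$-sum. *)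

theory Defs
  imports "HOL-Analysis.Analysis"
begin

definition M01 :: "real measure" where
  "M01 = restrict_space lborel {0..1}"

definition rademacher :: "nat \<Rightarrow> real \<Rightarrow> real" where
  "rademacher k t = sgn (sin (2 ^ k * pi * t))"

text \<open>Walsh functions in Paley numbering: w_n = prod of r_(i+1) over the bits i of n
  (bit i of n counted from 0; all bits i >= n vanish since n < 2^n).\<close>
definition walsh :: "nat \<Rightarrow> real \<Rightarrow> real" where
  "walsh n t = (\<Prod>i<n. if odd (n div 2 ^ i) then rademacher (Suc i) t else 1)"

definition lacunary :: "real \<Rightarrow> (nat \<Rightarrow> nat) \<Rightarrow> bool" where
  "lacunary q n \<longleftrightarrow> (\<forall>k. real (n (Suc k)) / real (n k) \<ge> q)"

definition is_L2_sum :: "(nat \<Rightarrow> real) \<Rightarrow> (nat \<Rightarrow> nat) \<Rightarrow> (real \<Rightarrow> real) \<Rightarrow> bool" where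
  "is_L2_sum a n f \<longleftrightarrow> f \<in> borel_measurable M01 \<and>
     ((\<lambda>K. \<integral>\<^sup>+ x. ennreal ((f x - (\<Sum>k<K. a k * walsh (n k) x))\<^sup>2) \<partial>M01) \<longlonglongrightarrow> 0)"

definition orlicz_M2_norm :: "(real \<Rightarrow> real) \<Rightarrow> real" where
  "orlicz_M2_norm f = Inf {c::real. 0 < c \<and>
      (\<integral>\<^sup>+ x. ennreal (exp ((\<bar>f x\<bar> / c)\<^sup>2) - 1) \<partial>M01) \<le> 1}"

definition ess_bounded :: "(real \<Rightarrow> real) \<Rightarrow> bool" where
  "ess_bounded f \<longleftrightarrow> f \<in> borel_measurable M01 \<and> (\<exists>B. AE x in M01. \<bar>f x\<bar> \<le> B)"

text \<open>A Banach function space X over [0,1] is encoded by its norm N, extended by \<infinity>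
  outside X: X = {f measurable. N f < \<infinity>}.\<close>
definition in_space :: "((real \<Rightarrow> real) \<Rightarrow> ennreal) \<Rightarrow> (real \<Rightarrow> real) \<Rightarrow> bool" where
  "in_space N f \<longleftrightarrow> f \<in> borel_measurable M01 \<and> N f < \<infinity>"

definition equimeasurable :: "(real \<Rightarrow> real) \<Rightarrow> (real \<Rightarrow> real) \<Rightarrow> bool" where
  "equimeasurable f g \<longleftrightarrow> (\<forall>t::real.
     emeasure M01 {x \<in> space M01. t < \<bar>f x\<bar>} = emeasure M01 {x \<in> space M01. t < \<bar>g x\<bar>})"

definition banach_function_space :: "((real \<Rightarrow> real) \<Rightarrow> ennreal) \<Rightarrow> bool" where
  "banach_function_space N \<longleftrightarrow>
     \<comment> \<open>norm depends only on the a.e. class\<close>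
     (\<forall>f g. f \<in> borel_measurable M01 \<longrightarrow> g \<in> borel_measurable M01 \<longrightarrow>
        (AE x in M01. f x = g x) \<longrightarrow> N f = N g) \<and>
     N (\<lambda>_. 0) = 0 \<and>
     (\<forall>f g. in_space N f \<longrightarrow> in_space N g \<longrightarrow> N (\<lambda>x. f x + g x) \<le> N f + N g) \<and>
     (\<forall>f c. in_space N f \<longrightarrow> N (\<lambda>x. c * f x) = ennreal \<bar>c\<bar> * N f) \<and>
     (\<forall>f. in_space N f \<longrightarrow> N f = 0 \<longrightarrow> (AE x in M01. f x = 0)) \<and>
     \<comment> \<open>ideal (lattice) property\<close>
     (\<forall>f g. in_space N g \<longrightarrow> f \<in> borel_measurable M01 \<longrightarrow>
        (AE x in M01. \<bar>f x\<bar> \<le> \<bar>g x\<bar>) \<longrightarrow> N f \<le> N g) \<and>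
     \<comment> \<open>completeness\<close>
     (\<forall>u. (\<forall>m. in_space N (u m)) \<longrightarrow>
        (\<forall>e>0. \<exists>K. \<forall>m\<ge>K. \<forall>n\<ge>K. N (\<lambda>x. u m x - u n x) < e) \<longrightarrow>
        (\<exists>f. in_space N f \<and> ((\<lambda>n. N (\<lambda>x. u n x - f x)) \<longlonglongrightarrow> 0)))"

definition ri_space :: "((real \<Rightarrow> real) \<Rightarrow> ennreal) \<Rightarrow> bool" where
  "ri_space N \<longleftrightarrow> banach_function_space N \<and>
     (\<forall>f g. f \<in> borel_measurable M01 \<longrightarrow> g \<in> borel_measurable M01 \<longrightarrow>
        equimeasurable f g \<longrightarrow> N f = N g)"

end

(* For Walsh functions lying in distinct dyadic blocks, the integral of exp (sum a_i w_(m_i)) is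
   the product of the cosh a_i: they behave like independent signs. A q-lacunary sequence splits
   into p such subsequences once q^p >= 2, so lacunary sums are subgaussian; this bounds their
   Orlicz norm, hence their norm in X, from above, and their fourth moment, hence (Paley-Zygmund and
   rearrangement invariance) their norm in X from below. Conversely, if some Walsh
   subsystem is equivalent in X to the unit vectors of l^2, it has infinitely many distinct members
   and contains an independent sequence. Its normalised sums have Gaussian lower tails
   (Paley-Zygmund for the exponential), so up to dilation and a bounded remainder they dominate the
   rearrangement of every bounded function of Orlicz norm 1; a single finite sum suffices for each
   bounded function, so no limit has to be taken in X. *)
theory Submission
  imports Defs
begin

subsection \<open>Walsh functions in distinct dyadic blocks\<close>

text \<open>The axioms give no Fatou property, so a comparison with a Gaussian limit in distribution
  would not carry over to the norm; this is why the tails are estimated with explicit constants at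
  each finite length. The lower tail estimate covers a limited range of levels: cosh has a Gaussian
  minorant only near 0, which restricts it to \<open>32 * s^2 <= n\<close>, and the exponential form
  of Paley-Zygmund loses constants that are absorbed only for \<open>s >= 3/8\<close>. The upper
  limit is harmless for a bounded function once n is large; the lower one is paid for by a multiple
  of the constant function. Passing from finite sums to square summable coefficients meets another
  obstacle: a limit in X and the L^2-sum are a priori unrelated functions. Rearrangement invariance
  bounds the norm from below by a weak-type quantity, so both modes of convergence imply convergence
  in measure and the limits agree.\<close>

lemma space_M01 [simp]: "space M01 = {0..1}"
  by (simp add: M01_def)

lemma emeasure_M01: "A \<in> sets M01 \<Longrightarrow> emeasure M01 A = emeasure lborel A"
  unfolding M01_def by (subst emeasure_restrict_space) (auto simp: sets_restrict_space)

interpretation M01: finite_measure M01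
  by (rule finite_measureI) (use emeasure_M01 [OF sets.top] in simp)

lemma measure_M01_space [simp]: "measure M01 {0..1} = 1"
  using emeasure_M01 [OF sets.top] by (simp add: measure_def)

lemma borel_measurable_M01:
  "f \<in> borel_measurable borel \<Longrightarrow> f \<in> borel_measurable M01"
  unfolding M01_def by (rule measurable_restrict_space1) simp

lemma AE_M01_iff: "(AE x in M01. P x) \<longleftrightarrow> (AE x in lborel. x \<in> {0..1} \<longrightarrow> P x)"
  unfolding M01_def by (subst AE_restrict_space_iff) auto

section \<open>The algebra of essentially bounded functions\<close>

lemma ess_boundedI:
  assumes "f \<in> borel_measurable M01" "AE x in M01. \<bar>f x\<bar> \<le> B"
  shows "ess_bounded f"
  using assms by (auto simp: ess_bounded_def)

lemma ess_boundedD [measurable_dest]: "ess_bounded f \<Longrightarrow> f \<in> borel_measurable M01"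
  by (simp add: ess_bounded_def)

lemma ess_bounded_integrable: "ess_bounded f \<Longrightarrow> integrable M01 f"
  unfolding ess_bounded_def using M01.integrable_const_bound[of f] by fastforce

lemma ess_bounded_const [simp]: "ess_bounded (\<lambda>_. c)"
  by (rule ess_boundedI[of _ "\<bar>c\<bar>"]) auto

lemma ess_bounded_add:
  assumes "ess_bounded f" "ess_bounded g" shows "ess_bounded (\<lambda>x. f x + g x)"
proof -
  obtain A B where AB: "AE x in M01. \<bar>f x\<bar> \<le> A" "AE x in M01. \<bar>g x\<bar> \<le> B"
    using assms by (auto simp: ess_bounded_def)
  show ?thesis
  proof (rule ess_boundedI)
    show "AE x in M01. \<bar>f x + g x\<bar> \<le> A + B" using AB by eventually_elim auto
  qed (use assms in measurable)
qed

lemma ess_bounded_mult: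
  assumes "ess_bounded f" "ess_bounded g" shows "ess_bounded (\<lambda>x. f x * g x)"
proof -
  obtain A B where AB: "AE x in M01. \<bar>f x\<bar> \<le> A" "AE x in M01. \<bar>g x\<bar> \<le> B"
    using assms by (auto simp: ess_bounded_def)
  show ?thesis
  proof (rule ess_boundedI)
    show "AE x in M01. \<bar>f x * g x\<bar> \<le> A * B"
      using AB
    proof eventually_elim
      case (elim x)
      then show ?case
        unfolding abs_mult by (intro mult_mono) auto
    qed
  qed (use assms in measurable)
qed

lemma ess_bounded_diff:
  assumes "ess_bounded f" "ess_bounded g" shows "ess_bounded (\<lambda>x. f x - g x)"
  using ess_bounded_add[OF assms(1) ess_bounded_mult[OF ess_bounded_const[of "-1"] assms(2)]]
  by simp

lemma ess_bounded_sum: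
  "(\<And>i. i \<in> I \<Longrightarrow> ess_bounded (f i)) \<Longrightarrow> ess_bounded (\<lambda>x. \<Sum>i\<in>I. f i x)"
  by (induction I rule: infinite_finite_induct) (auto intro: ess_bounded_add)

lemma ess_bounded_power: "ess_bounded f \<Longrightarrow> ess_bounded (\<lambda>x. f x ^ k)"
  by (induction k) (auto intro: ess_bounded_mult)

lemma ess_bounded_exp:
  assumes "ess_bounded f" shows "ess_bounded (\<lambda>x. exp (f x))"
proof -
  obtain A where A: "AE x in M01. \<bar>f x\<bar> \<le> A"
    using assms by (auto simp: ess_bounded_def)
  show ?thesis
  proof (rule ess_boundedI)
    show "AE x in M01. \<bar>exp (f x)\<bar> \<le> exp A" using A by eventually_elim auto
  qed (use assms in measurable)
qed

lemmas ess_bounded_intros =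
  ess_bounded_const ess_bounded_add ess_bounded_mult ess_bounded_diff ess_bounded_sum
  ess_bounded_power ess_bounded_exp

section \<open>Walsh functions as a group of characters\<close>

lemma rademacher_measurable [measurable]: "rademacher k \<in> borel_measurable borel"
  unfolding rademacher_def [abs_def] by measurable

lemma walsh_measurable [measurable]: "walsh n \<in> borel_measurable borel"
proof -
  have "(\<lambda>t. if odd (n div 2 ^ i) then rademacher (Suc i) t else 1) \<in> borel_measurable borel" for i
    by (cases "odd (n div 2 ^ i)") auto
  then show ?thesis
    unfolding walsh_def [abs_def] by (intro borel_measurable_prod)
qed

lemma walsh_measurable_M01 [measurable]: "walsh n \<in> borel_measurable M01"
  by (rule borel_measurable_M01) measurable

text \<open>At dyadic rationals a sine vanishes and \<open>sgn\<close> gives 0, so the sign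
  identities hold only off a countable set. The later AE statements on Walsh functions originate
  here.\<close>

lemma AE_rademacher_square: "AE x in M01. \<forall>k. rademacher k x * rademacher k x = 1"
proof -
  let ?D = "range (\<lambda>(i::int, k::nat). real_of_int i / 2 ^ k)"
  have "AE x in lborel. x \<notin> ?D"
    by (intro AE_not_in null_setsI countable_imp_null_set_lborel) auto
  then have "AE x in lborel. x \<in> {0..1} \<longrightarrow> (\<forall>k. rademacher k x * rademacher k x = 1)"
  proof eventually_elim
    case (elim x)
    have "sin (2 ^ k * pi * x) \<noteq> 0" for k
    proof
      assume "sin (2 ^ k * pi * x) = 0"
      then obtain i :: int where "2 ^ k * pi * x = of_int i * pi"
        by (auto simp: sin_zero_iff_int2)
      then have "x = of_int i / 2 ^ k" by (simp add: field_simps)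
      then show False using elim by (auto intro!: image_eqI[where x = "(i, k)"])
    qed
    then show ?case by (auto simp: rademacher_def sgn_if)
  qed
  then show ?thesis by (simp add: AE_M01_iff)
qed

text \<open>In the definition of \<open>walsh n\<close> the range of the product depends on n. A
  common range allows different Walsh functions to be multiplied factor by factor.\<close>

lemma walsh_eq_prod_bit:
  assumes "n < 2 ^ L"
  shows "walsh n t = (\<Prod>i<L. if bit n i then rademacher (Suc i) t else 1)"
proof -
  have *: "\<not> bit n i" if "n < 2 ^ K" "K \<le> i" for i K
  proof -
    have "(2::nat) ^ K \<le> 2 ^ i" using that by simp
    then have "n div 2 ^ i = 0" using that by (intro div_less) linarith
    then show ?thesis by (simp add: bit_iff_odd)
  qed
  have "(\<Prod>i<n. if bit n i then rademacher (Suc i) t else 1)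
      = (\<Prod>i<max n L. if bit n i then rademacher (Suc i) t else 1)"
    by (rule prod.mono_neutral_left) (auto dest: *[OF less_exp])
  moreover have "(\<Prod>i<L. if bit n i then rademacher (Suc i) t else 1)
      = (\<Prod>i<max n L. if bit n i then rademacher (Suc i) t else 1)"
    by (rule prod.mono_neutral_left) (auto dest: *[OF assms])
  ultimately show ?thesis by (simp add: walsh_def bit_iff_odd)
qed

lemma xor_less_exp: "(a::nat) < 2 ^ L \<Longrightarrow> b < 2 ^ L \<Longrightarrow> xor a b < 2 ^ L"
  by (simp flip: take_bit_nat_eq_self_iff)

text \<open>Digits common to both indices contribute a squared Rademacher function, which is 1 a.e.
  Integrals of products thereby reduce to integrals of single Walsh functions.\<close>

lemma AE_walsh_mult: "AE x in M01. \<forall>a b. walsh a x * walsh b x = walsh (xor a b) x"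
  using AE_rademacher_square
proof eventually_elim
  case (elim x)
  show ?case
  proof (intro allI)
    fix a b :: nat
    let ?L = "max a b"
    have "a < 2 ^ ?L" "b < 2 ^ ?L"
      by (meson less_exp less_le_trans max.cobounded1 max.cobounded2 one_le_numeral power_increasing)+
    note L = this xor_less_exp[OF this]
    show "walsh a x * walsh b x = walsh (xor a b) x"
      unfolding walsh_eq_prod_bit[OF L(1)] walsh_eq_prod_bit[OF L(2)] walsh_eq_prod_bit[OF L(3)]
        prod.distrib[symmetric]
      by (rule prod.cong) (auto simp: bit_xor_iff elim)
  qed
qed

lemma walsh_0 [simp]: "walsh 0 x = 1"
  by (simp add: walsh_def)

lemma AE_walsh_square: "AE x in M01. \<forall>n. walsh n x * walsh n x = 1"
  using AE_walsh_mult by eventually_elim auto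

lemma AE_walsh_pm1: "AE x in M01. \<forall>n. walsh n x = 1 \<or> walsh n x = -1"
  using AE_walsh_square by eventually_elim (simp add: square_eq_1_iff)

lemma ess_bounded_walsh [simp]: "ess_bounded (walsh n)"
proof (rule ess_boundedI)
  show "AE x in M01. \<bar>walsh n x\<bar> \<le> 1"
    using AE_walsh_pm1 by eventually_elim (auto dest: spec[of _ n])
qed measurable

text \<open>Shifting by \<open>2\<^sup>-\<^sup>k\<close>, where \<open>k\<close> belongs to the lowest binary digit of \<open>n\<close>,
  flips exactly one of the Rademacher factors of \<open>walsh n\<close>.\<close>
lemma walsh_shift:
  assumes "n > 0"
  obtains k where "\<And>x. walsh n (x + 1 / 2 ^ Suc k) = - walsh n x" "\<And>x. walsh n (x + 1) = walsh n x"
proof -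
  define k where "k = (LEAST i. bit n i)"
  have "\<exists>i. bit n i" using assms by (metis bit_eq_iff bit_0_eq bot_apply bot_bool_def not_gr_zero)
  then have k: "bit n k" unfolding k_def by (rule LeastI_ex)
  have low: "\<not> bit n i" if "i < k" for i using not_less_Least that unfolding k_def by blast
  have per: "rademacher (Suc i) (x + of_nat j / 2 ^ i) = rademacher (Suc i) x" for i j x
  proof -
    have "2 ^ Suc i * pi * (x + of_nat j / 2 ^ i) = 2 ^ Suc i * pi * x + 2 * of_nat j * pi"
      by (simp add: field_simps)
    moreover have "sin (y + 2 * of_nat j * pi) = sin y" for y
      unfolding sin_add using sin_2npi[of j] cos_2npi[of j] by (simp add: mult.assoc)
    ultimately show ?thesis
      unfolding rademacher_def by simp
  qed
  have k_less: "k < n"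
  proof (rule ccontr)
    assume "\<not> k < n"
    then have "n < 2 ^ k" by (meson less_exp less_le_trans not_less less_imp_le le_less_trans)
    then show False using k by (simp add: bit_iff_odd)
  qed
  have 1: "walsh n (x + 1) = walsh n x" for x
  proof -
    have "rademacher (Suc i) (x + 1) = rademacher (Suc i) x" for i
      using per[of i x "2 ^ i"] by simp
    then show ?thesis unfolding walsh_def by (intro prod.cong) auto
  qed
  have flip: "rademacher (Suc k) (x + 1 / 2 ^ Suc k) = - rademacher (Suc k) x" for x
  proof -
    have "2 ^ Suc k * pi * (x + 1 / 2 ^ Suc k) = 2 ^ Suc k * pi * x + pi"
      by (simp add: field_simps)
    then show ?thesis unfolding rademacher_def by (simp only: sin_periodic_pi sgn_minus)
  qed
  have 2: "walsh n (x + 1 / 2 ^ Suc k) = - walsh n x" for x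
  proof -
    let ?f = "\<lambda>t i. if bit n i then rademacher (Suc i) t else 1"
    have "?f (x + 1 / 2 ^ Suc k) i = ?f x i" if "i \<noteq> k" for i
    proof (cases "i < k")
      case False
      then have "Suc k \<le> i" using that by simp
      \<comment> \<open>For digits above k the shift is a whole multiple of the period
        \<open>1 / 2 ^ i\<close>.\<close>
      then have "(1::real) / 2 ^ Suc k = of_nat (2 ^ (i - Suc k)) / 2 ^ i"
        by (simp add: field_simps flip: power_add power_Suc)
      then show ?thesis by (simp only: per)
    qed (use low in auto)
    then have "(\<Prod>i\<in>{..<n} - {k}. ?f (x + 1 / 2 ^ Suc k) i) = (\<Prod>i\<in>{..<n} - {k}. ?f x i)"
      by (intro prod.cong) auto
    then show ?thesis
      using k_less k flip[of x]
      unfolding walsh_def bit_iff_odd[symmetric] by (subst (1 2) prod.remove[of _ k]) auto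
  qed
  show ?thesis using that 1 2 by blast
qed

text \<open>For positive n, the integral over a full period is invariant under translation, while
  the shift of \<open>walsh_shift\<close> reverses the sign of the integrand; so the integral equals
  its own negative.\<close>

lemma integral_walsh: "(\<integral>x. walsh n x \<partial>M01) = (if n = 0 then 1 else 0)"
proof (cases "n = 0")
  case True
  then show ?thesis by simp
next
  case False
  obtain k where k: "\<And>x. walsh n (x + 1 / 2 ^ Suc k) = - walsh n x" "\<And>x. walsh n (x + 1) = walsh n x"
    using walsh_shift False by blast
  define h :: real where "h = 1 / 2 ^ Suc k"
  have h: "0 < h" "h < 1" by (auto simp: h_def field_simps intro: le_less_trans[OF one_le_power[of 2 k]])
  let ?w = "walsh n"
  have bd: "\<bar>?w x\<bar> \<le> 1" for x
    unfolding walsh_def abs_prod by (intro prod_le_1) (auto simp: rademacher_def sgn_if)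
  have I: "set_integrable lborel {a..b} ?w" for a b :: real
    unfolding set_integrable_def
    by (rule Bochner_Integration.integrable_bound[of _ "indicator {a..b} :: real \<Rightarrow> real"])
       (auto simp: indicator_def bd emeasure_lborel_Icc_eq intro!: integrable_real_indicator)
  have shift: "(LBINT x:{a..b}. ?w (x + t)) = (LBINT x:{a+t..b+t}. ?w x)" for a b t :: real
    unfolding set_lebesgue_integral_def
    by (subst lborel_integral_real_affine[of 1 "\<lambda>x. indicator {a+t..b+t} x *\<^sub>R ?w x" t])
       (auto simp: indicator_def add.commute intro!: Bochner_Integration.integral_cong)
  have split: "(LBINT x:{a..c}. ?w x) = (LBINT x:{a..b}. ?w x) + (LBINT x:{b..c}. ?w x)"
    if "a \<le> b" "b \<le> c" for a b c :: real
  proof -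
    have "{a..c} = {a..b} \<union> {b..c}" using that by auto
    then show ?thesis
      by (simp, intro set_integral_Un_AE) (use that AE_lborel_singleton[of b] I in auto)
  qed
  have "(LBINT x:{0..1}. ?w x) = - (LBINT x:{0..1}. ?w (x + h))"
    using k(1) by (simp add: h_def set_lebesgue_integral_def)
  also have "(LBINT x:{0..1}. ?w (x + h)) = (LBINT x:{h..1+h}. ?w x)"
    using shift[of 0 1 h] by simp
  also have "\<dots> = (LBINT x:{h..1}. ?w x) + (LBINT x:{1..1+h}. ?w x)"
    using h by (intro split) auto
  also have "(LBINT x:{1..1+h}. ?w x) = (LBINT x:{0..h}. ?w x)"
    using shift[of 0 h 1] k(2) by (simp add: add.commute)
  also have "(LBINT x:{h..1}. ?w x) + (LBINT x:{0..h}. ?w x) = (LBINT x:{0..1}. ?w x)"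
    using split[of 0 h 1] h by simp
  finally have "(LBINT x:{0..1}. ?w x) = 0" by simp
  moreover have "(\<integral>x. ?w x \<partial>M01) = (LBINT x:{0..1}. ?w x)"
    unfolding M01_def set_lebesgue_integral_def by (subst integral_restrict_space) auto
  ultimately show ?thesis using False by simp
qed

section \<open>Walsh functions with separated indices as independent signs\<close>

definition dyadic_separated :: "(nat \<Rightarrow> nat) \<Rightarrow> bool" where
  "dyadic_separated m \<longleftrightarrow> 0 < m 0 \<and> (\<forall>i. \<exists>t. m i < 2 ^ t \<and> 2 ^ t \<le> m (Suc i))"

text \<open>Up to null sets these are the step functions on the dyadic intervals of length
  \<open>1 / 2 ^ t\<close>. Equality is asked only a.e. because products of Walsh functions reduce
  to Walsh functions only a.e.\<close>

definition walsh_polynomial :: "nat \<Rightarrow> (real \<Rightarrow> real) \<Rightarrow> bool" where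
  "walsh_polynomial t F \<longleftrightarrow> (\<exists>b. AE x in M01. F x = (\<Sum>M<2^t. b M * walsh M x))"

lemma walsh_polynomial_mono:
  assumes "walsh_polynomial t F" "t \<le> u" shows "walsh_polynomial u F"
proof -
  obtain b where b: "AE x in M01. F x = (\<Sum>M<2^t. b M * walsh M x)"
    using assms by (auto simp: walsh_polynomial_def)
  have le: "(2::nat) ^ t \<le> 2 ^ u" using assms(2) by simp
  have "(\<Sum>M<2^t. b M * walsh M x) = (\<Sum>M<2^u. (if M < 2^t then b M else 0) * walsh M x)" for x
    using le by (intro sum.mono_neutral_cong_left) auto
  then show ?thesis using b by (auto simp: walsh_polynomial_def)
qed

lemma walsh_polynomial_add:
  assumes "walsh_polynomial t F" "walsh_polynomial t G"
  shows "walsh_polynomial t (\<lambda>x. F x + G x)"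
proof -
  obtain b c where "AE x in M01. F x = (\<Sum>M<2^t. b M * walsh M x)"
    "AE x in M01. G x = (\<Sum>M<2^t. c M * walsh M x)"
    using assms by (auto simp: walsh_polynomial_def)
  then have "AE x in M01. F x + G x = (\<Sum>M<2^t. (b M + c M) * walsh M x)"
    by eventually_elim (simp add: algebra_simps sum.distrib)
  then show ?thesis by (auto simp: walsh_polynomial_def)
qed

lemma walsh_polynomial_cmult:
  assumes "walsh_polynomial t F"
  shows "walsh_polynomial t (\<lambda>x. c * F x)"
proof -
  obtain b where "AE x in M01. F x = (\<Sum>M<2^t. b M * walsh M x)"
    using assms by (auto simp: walsh_polynomial_def)
  then have "AE x in M01. c * F x = (\<Sum>M<2^t. (c * b M) * walsh M x)"
    by eventually_elim (simp add: sum_distrib_left mult.assoc)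
  then show ?thesis by (auto simp: walsh_polynomial_def)
qed

lemma walsh_polynomial_mult_walsh:
  assumes "walsh_polynomial t F" "m < 2 ^ t"
  shows "walsh_polynomial t (\<lambda>x. F x * walsh m x)"
proof -
  obtain b where b: "AE x in M01. F x = (\<Sum>M<2^t. b M * walsh M x)"
    using assms by (auto simp: walsh_polynomial_def)
  have "AE x in M01. F x * walsh m x = (\<Sum>M<2^t. b (xor M m) * walsh M x)"
    using b AE_walsh_mult
  proof eventually_elim
    case (elim x)
    have "F x * walsh m x = (\<Sum>M<2^t. b M * walsh (xor M m) x)"
      using elim by (simp add: sum_distrib_right mult.assoc)
    \<comment> \<open>The map \<open>M -> xor M m\<close> is an involution of the indices below
      \<open>2 ^ t\<close>, as m itself lies below \<open>2 ^ t\<close>.\<close>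
    also have "\<dots> = (\<Sum>M<2^t. b (xor M m) * walsh M x)"
      by (rule sum.reindex_bij_witness[of _ "\<lambda>M. xor M m" "\<lambda>M. xor M m"])
         (use assms(2) in \<open>auto simp: xor.assoc xor_less_exp\<close>)
    finally show ?case .
  qed
  then show ?thesis by (auto simp: walsh_polynomial_def)
qed

lemma integral_walsh_polynomial_mult_walsh:
  assumes F: "walsh_polynomial t F" "F \<in> borel_measurable M01" and m: "2 ^ t \<le> m"
  shows "(\<integral>x. F x * walsh m x \<partial>M01) = 0"
proof -
  obtain b where b: "AE x in M01. F x = (\<Sum>M<2^t. b M * walsh M x)"
    using F by (auto simp: walsh_polynomial_def)
  have "(\<integral>x. F x * walsh m x \<partial>M01) = (\<integral>x. (\<Sum>M<2^t. b M * walsh (xor M m) x) \<partial>M01)"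
  proof (rule integral_cong_AE)
    show "AE x in M01. F x * walsh m x = (\<Sum>M<2^t. b M * walsh (xor M m) x)"
      using b AE_walsh_mult by eventually_elim (simp add: sum_distrib_right mult.assoc)
  qed (use F in measurable)
  also have "\<dots> = (\<Sum>M<2^t. b M * (\<integral>x. walsh (xor M m) x \<partial>M01))"
    by (simp add: ess_bounded_integrable)
  also have "\<dots> = 0"
  proof (rule sum.neutral, intro ballI)
    fix M :: nat assume "M \<in> {..<2 ^ t}"
    then have "M \<noteq> m" using m by auto
    then have "xor M m \<noteq> 0"
      by (metis xor.assoc xor.left_neutral xor.right_neutral xor_self_eq)
    then show "b M * (\<integral>x. walsh (xor M m) x \<partial>M01) = 0" by (simp add: integral_walsh)
  qed
  finally show ?thesis .
qed

text \<open>Walsh functions from different dyadic blocks behave like independent signs: each one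
  is orthogonal to every polynomial in the preceding ones.\<close>
lemma dyadic_separated_product:
  fixes c s :: "nat \<Rightarrow> real"
  assumes m: "dyadic_separated m"
  defines "F \<equiv> \<lambda>n x. \<Prod>i<n. (c i + s i * walsh (m i) x)"
  shows "ess_bounded (F n)" "(\<exists>t. 2 ^ t \<le> m n \<and> walsh_polynomial t (F n)) \<and> (\<integral>x. F n x \<partial>M01) = (\<Prod>i<n. c i)"
proof -
  show bd: "ess_bounded (F n)" for n
    unfolding F_def by (induction n) (auto intro!: ess_bounded_intros)
  show "(\<exists>t. 2 ^ t \<le> m n \<and> walsh_polynomial t (F n)) \<and> (\<integral>x. F n x \<partial>M01) = (\<Prod>i<n. c i)"
  \<comment> \<open>Both claims are carried together: the level t, at most on the scale of
    \<open>m n\<close>, is what makes the integral of \<open>F n\<close> times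
    \<open>walsh (m n)\<close> vanish in the next step.\<close>
  proof (induction n)
    case 0
    have "walsh_polynomial 0 (F 0)"
      unfolding walsh_polynomial_def F_def by (intro exI[of _ "\<lambda>_. 1"]) simp
    moreover have "(2::nat) ^ 0 \<le> m 0" using m by (simp add: dyadic_separated_def Suc_leI)
    moreover have "(\<integral>x. F 0 x \<partial>M01) = 1" by (simp add: F_def)
    ultimately show ?case by (metis lessThan_0 prod.empty)
  next
    case (Suc n)
    then obtain t where t: "2 ^ t \<le> m n" "walsh_polynomial t (F n)" by auto
    obtain u where u: "m n < 2 ^ u" "2 ^ u \<le> m (Suc n)"
      using m by (auto simp: dyadic_separated_def)
    have "(2::nat) ^ t < 2 ^ u" using t u by linarith
    then have "t \<le> u" by simp
    then have Fu: "walsh_polynomial u (F n)" using walsh_polynomial_mono t by blast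
    have eq: "F (Suc n) = (\<lambda>x. c n * F n x + s n * (F n x * walsh (m n) x))"
      by (auto simp: F_def algebra_simps)
    have "walsh_polynomial u (F (Suc n))"
      unfolding eq
      by (intro walsh_polynomial_add walsh_polynomial_cmult walsh_polynomial_mult_walsh Fu u)
    moreover have "(\<integral>x. F (Suc n) x \<partial>M01) = (\<Prod>i<Suc n. c i)"
    proof -
      have "(\<integral>x. F n x * walsh (m n) x \<partial>M01) = 0"
        using t bd by (intro integral_walsh_polynomial_mult_walsh) auto
      then show ?thesis
        using Suc.IH unfolding eq
        by (subst Bochner_Integration.integral_add)
           (auto intro!: ess_bounded_integrable ess_bounded_intros bd)
    qed
    ultimately show ?case using u by auto
  qed
qed

lemma integral_exp_dyadic_separated:
  assumes "dyadic_separated m"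
  shows "(\<integral>x. exp (\<Sum>i<n. a i * walsh (m i) x) \<partial>M01) = (\<Prod>i<n. cosh (a i))"
proof -
  have "(\<integral>x. exp (\<Sum>i<n. a i * walsh (m i) x) \<partial>M01)
      = (\<integral>x. (\<Prod>i<n. cosh (a i) + sinh (a i) * walsh (m i) x) \<partial>M01)"
  proof (rule integral_cong_AE)
    show "AE x in M01. exp (\<Sum>i<n. a i * walsh (m i) x)
        = (\<Prod>i<n. cosh (a i) + sinh (a i) * walsh (m i) x)"
      using AE_walsh_pm1
    proof eventually_elim
      case (elim x)
      \<comment> \<open>On the two values 1 and -1 the exponential coincides with an affine
        function.\<close>
      have "exp (a i * walsh (m i) x) = cosh (a i) + sinh (a i) * walsh (m i) x" for i
        using elim[rule_format, of "m i"] by (auto simp: cosh_plus_sinh cosh_minus_sinh)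
      then show ?case by (simp add: exp_sum)
    qed
  qed measurable
  also have "\<dots> = (\<Prod>i<n. cosh (a i))"
    using dyadic_separated_product(2)[OF assms] by auto
  finally show ?thesis .
qed

section \<open>Gaussian bounds for the hyperbolic cosine\<close>

lemma cosh_le_exp: "cosh (x::real) \<le> exp (x\<^sup>2 / 2)"
proof -
  \<comment> \<open>Comparing the coefficients of \<open>x ^ (2 * n)\<close> in the two power series
    reduces the claim to this inequality.\<close>
  have fact_ge: "2 ^ n * fact n \<le> (fact (2 * n) :: real)" for n
  proof (induction n)
    case (Suc n)
    have "2 ^ Suc n * fact (Suc n) = (2 * real (Suc n)) * (2 ^ n * fact n :: real)"
      by (simp add: algebra_simps)
    also have "\<dots> \<le> (real (2 * n + 2) * real (2 * n + 1)) * fact (2 * n)"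
      by (intro mult_mono Suc) (auto simp: algebra_simps)
    also have "\<dots> = fact (2 * Suc n)"
      by (simp add: algebra_simps)
    finally show ?case .
  qed simp
  have "(\<lambda>n. if even n then x ^ n /\<^sub>R fact n else 0) sums cosh x"
    by (rule cosh_converges)
  then have 1: "(\<lambda>n. x ^ (2 * n) /\<^sub>R fact (2 * n)) sums cosh x"
    using sums_mono_reindex[of "\<lambda>n. 2 * n" "\<lambda>n. if even n then x ^ n /\<^sub>R fact n else 0" "cosh x"]
    by (simp add: strict_mono_def) (metis (lifting) evenE rangeI)
  have 2: "(\<lambda>n. (x\<^sup>2 / 2) ^ n /\<^sub>R fact n) sums exp (x\<^sup>2 / 2)"
    by (rule exp_converges)
  show ?thesis
  proof (rule sums_le[OF _ 1 2])
    fix n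
    have "x ^ (2 * n) / fact (2 * n) \<le> x ^ (2 * n) / (2 ^ n * fact n)"
      by (intro divide_left_mono fact_ge) (auto simp: zero_le_power_eq)
    then show "x ^ (2 * n) /\<^sub>R fact (2 * n) \<le> (x\<^sup>2 / 2) ^ n /\<^sub>R fact n"
      by (simp add: field_simps power_divide flip: power_mult)
  qed
qed

text \<open>All terms are nonnegative. The first three terms serve the quadratic lower bound, a
  single term the moment bounds.\<close>

lemma cosh_series_partial_le:
  fixes x :: real
  assumes "finite I"
  shows "(\<Sum>n\<in>I. if even n then x ^ n /\<^sub>R fact n else 0) \<le> cosh x"
  using sum_le_suminf[OF sums_summable[OF cosh_converges[of x]] assms] sums_unique[OF cosh_converges[of x]]
  by (auto simp: zero_le_power_eq)

text \<open>Since cosh grows only exponentially, such a minorant is confined to a bounded range.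
  With \<open>y = x^2 / 4 <= 1/2\<close> one has \<open>exp y <= 1 + y + y^2 <= 1 + 2 * y\<close>,
  and the right side is a partial sum of the cosh series.\<close>

lemma cosh_ge_exp:
  assumes "x\<^sup>2 \<le> 2" shows "exp (x\<^sup>2 / 4) \<le> cosh (x::real)"
proof -
  have "exp (x\<^sup>2 / 4) \<le> 1 + x\<^sup>2 / 4 + (x\<^sup>2 / 4)\<^sup>2"
    using assms by (intro exp_bound) auto
  also have "\<dots> \<le> 1 + x\<^sup>2 / 2"
    using assms mult_mono[of "x\<^sup>2/4" 1 "x\<^sup>2/4" "x\<^sup>2/4"] by (simp add: power2_eq_square)
  also have "\<dots> \<le> cosh x"
  proof -
    have "(\<Sum>n<3. if even n then x ^ n /\<^sub>R fact n else 0) \<le> cosh x"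
      by (rule cosh_series_partial_le) simp
    then show ?thesis by (simp add: numeral_3_eq_3 numeral_2_eq_2 power2_eq_square field_simps)
  qed
  finally show ?thesis .
qed

subsection \<open>Subgaussian sums\<close>

text \<open>Off the set, \<open>Y <= a / 2\<close>; on it,
  \<open>Y <= \<tau> / 2 * Y^2 + 1 / (2 * \<tau>)\<close> by completing the square. Integrating this
  pointwise bound takes the place of the Cauchy-Schwarz inequality.\<close>

lemma paley_zygmund:
  assumes Y: "ess_bounded Y" and a: "0 < a" "a \<le> (\<integral>x. Y x \<partial>M01)"
    and b: "(\<integral>x. (Y x)\<^sup>2 \<partial>M01) \<le> b"
  shows "a\<^sup>2 / (4 * b) \<le> measure M01 {x \<in> {0..1}. a / 2 < Y x}"
proof (cases "b > 0")
  case False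
  then have "a\<^sup>2 / (4 * b) \<le> 0" by (intro divide_nonneg_nonpos) auto
  then show ?thesis by (meson measure_nonneg order_trans)
next
  case True
  define E where "E = {x \<in> {0..1}. a / 2 < Y x}"
  \<comment> \<open>With this value the second moment contributes at most \<open>a / 4\<close>,
    which leaves \<open>a / 4\<close> for the set E.\<close>
  define \<tau> where "\<tau> = a / (2 * b)"
  have \<tau>: "\<tau> > 0" using True a by (simp add: \<tau>_def)
  have E: "E \<in> sets M01"
  proof -
    have "{x \<in> space M01. a / 2 < Y x} \<in> sets M01" using Y by measurable
    then show ?thesis by (simp add: E_def)
  qed
  have ptw: "Y x \<le> a / 2 + (\<tau> / 2) * (Y x)\<^sup>2 + (1 / (2 * \<tau>)) * indicator E x" if "x \<in> {0..1}" for x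
  proof (cases "a / 2 < Y x")
    case True
    have "0 \<le> (\<tau> * Y x - 1)\<^sup>2 / (2 * \<tau>)" using \<tau> by simp
    also have "\<dots> = (\<tau> / 2) * (Y x)\<^sup>2 - Y x + 1 / (2 * \<tau>)"
      using \<tau> by (simp add: power2_eq_square field_simps)
    finally show ?thesis using True that a by (simp add: E_def)
  next
    case False
    have "0 \<le> (\<tau> / 2) * (Y x)\<^sup>2" using \<tau> by simp
    then show ?thesis using False by (simp add: E_def)
  qed
  have I: "integrable M01 Y" "integrable M01 (\<lambda>x. (Y x)\<^sup>2)"
    using Y by (auto intro!: ess_bounded_integrable ess_bounded_intros)
  have IE: "integrable M01 (indicator E :: real \<Rightarrow> real)"
    using E by (intro integrable_real_indicator) (auto simp: less_top[symmetric])
  have "a \<le> (\<integral>x. Y x \<partial>M01)" by fact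
  also have "\<dots> \<le> (\<integral>x. a / 2 + (\<tau> / 2) * (Y x)\<^sup>2 + (1 / (2 * \<tau>)) * indicator E x \<partial>M01)"
    using ptw
    by (intro integral_mono Bochner_Integration.integrable_add integrable_mult_right I IE) auto
  also have "\<dots> = a / 2 + (\<tau> / 2) * (\<integral>x. (Y x)\<^sup>2 \<partial>M01) + (1 / (2 * \<tau>)) * measure M01 E"
  proof -
    have "E \<inter> {0..1} = E" by (auto simp: E_def)
    then show ?thesis using I IE E by simp
  qed
  also have "\<dots> \<le> a / 2 + (\<tau> / 2) * b + (1 / (2 * \<tau>)) * measure M01 E"
    using \<tau> b by simp
  also have "\<dots> = a / 2 + a / 4 + (b / a) * measure M01 E"
    using True a by (simp add: \<tau>_def)
  finally show ?thesis using True a unfolding E_def[symmetric] by (simp add: field_simps power2_eq_square)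
qed

text \<open>Letting l take both signs controls both tails. \<open>ess_bounded\<close> ensures that
  the Bochner integrals exist and are not the default value 0.\<close>

definition subgaussian :: "real \<Rightarrow> (real \<Rightarrow> real) \<Rightarrow> bool" where
  "subgaussian \<sigma> S \<longleftrightarrow> ess_bounded S \<and> (\<forall>l. (\<integral>x. exp (l * S x) \<partial>M01) \<le> exp (l\<^sup>2 * \<sigma>\<^sup>2 / 2))"

lemma subgaussian_mono:
  assumes "subgaussian \<sigma> S" "0 \<le> \<sigma>" "\<sigma> \<le> \<rho>" shows "subgaussian \<rho> S"
proof -
  have "exp (l\<^sup>2 * \<sigma>\<^sup>2 / 2) \<le> exp (l\<^sup>2 * \<rho>\<^sup>2 / 2)" for l :: real
    using assms by (auto intro!: mult_left_mono power_mono)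
  then show ?thesis
    using assms(1) unfolding subgaussian_def by (meson order_trans)
qed

lemma subgaussian_dyadic_separated:
  fixes a :: "nat \<Rightarrow> real"
  assumes "dyadic_separated m"
  shows "subgaussian (sqrt (\<Sum>i<n. (a i)\<^sup>2)) (\<lambda>x. \<Sum>i<n. a i * walsh (m i) x)"
  unfolding subgaussian_def
proof (intro conjI allI)
  fix l :: real
  have "(\<integral>x. exp (l * (\<Sum>i<n. a i * walsh (m i) x)) \<partial>M01) = (\<Prod>i<n. cosh (l * a i))"
    using integral_exp_dyadic_separated[OF assms, where n = n and a = "\<lambda>i. l * a i"]
    by (simp add: sum_distrib_left mult.assoc)
  also have "\<dots> \<le> (\<Prod>i<n. exp ((l * a i)\<^sup>2 / 2))"
    by (intro prod_mono) (auto simp: cosh_le_exp)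
  also have "\<dots> = exp (l\<^sup>2 * (sqrt (\<Sum>i<n. (a i)\<^sup>2))\<^sup>2 / 2)"
    by (simp add: exp_sum[symmetric] sum_nonneg sum_distrib_left sum_divide_distrib power_mult_distrib)
  finally show "(\<integral>x. exp (l * (\<Sum>i<n. a i * walsh (m i) x)) \<partial>M01)
    \<le> exp (l\<^sup>2 * (sqrt (\<Sum>i<n. (a i)\<^sup>2))\<^sup>2 / 2)" .
qed (auto intro!: ess_bounded_intros)

text \<open>Jensen's inequality for the mean of the functions \<open>p * l * T r\<close>. The
  summands may depend on each other arbitrarily, at the price of the factor p in place of its square
  root.\<close>

lemma subgaussian_sum:
  assumes p: "0 < p" and T: "\<And>r. r < p \<Longrightarrow> subgaussian \<sigma> (T r)"
  shows "subgaussian (real p * \<sigma>) (\<lambda>x. \<Sum>r<p. T r x)"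
  unfolding subgaussian_def
proof (intro conjI allI)
  have bd: "ess_bounded (T r)" if "r < p" for r using T[OF that] by (simp add: subgaussian_def)
  then show bdS: "ess_bounded (\<lambda>x. \<Sum>r<p. T r x)" by (intro ess_bounded_sum) auto
  fix l :: real
  have conv: "exp (l * (\<Sum>r<p. T r x)) \<le> (\<Sum>r<p. (1 / real p) * exp (real p * l * T r x))" for x
  proof -
    have "convex_on UNIV (exp :: real \<Rightarrow> real)" by (rule exp_convex)
    then have "exp (\<Sum>r<p. (1 / real p) *\<^sub>R (real p * l * T r x)) \<le> (\<Sum>r<p. (1 / real p) * exp (real p * l * T r x))"
      using p by (intro convex_on_sum[where C = UNIV]) auto
    moreover have "(\<Sum>r<p. (1 / real p) *\<^sub>R (real p * l * T r x)) = l * (\<Sum>r<p. T r x)"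
      using p by (simp add: sum_distrib_left)
    ultimately show ?thesis by simp
  qed
  have "(\<integral>x. exp (l * (\<Sum>r<p. T r x)) \<partial>M01) \<le> (\<integral>x. (\<Sum>r<p. (1 / real p) * exp (real p * l * T r x)) \<partial>M01)"
    using bd bdS conv by (intro integral_mono ess_bounded_integrable ess_bounded_intros) auto
  also have "\<dots> = (\<Sum>r<p. (1 / real p) * (\<integral>x. exp (real p * l * T r x) \<partial>M01))"
    using bd by (subst Bochner_Integration.integral_sum)
      (auto intro!: ess_bounded_integrable ess_bounded_intros simp: divide_inverse)
  also have "\<dots> \<le> (\<Sum>r<p. (1 / real p) * exp ((real p * l)\<^sup>2 * \<sigma>\<^sup>2 / 2))"
    using T by (intro sum_mono mult_left_mono) (auto simp: subgaussian_def)
  also have "\<dots> = exp (l\<^sup>2 * (real p * \<sigma>)\<^sup>2 / 2)"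
    using p by (simp add: power_mult_distrib mult_ac)
  finally show "(\<integral>x. exp (l * (\<Sum>r<p. T r x)) \<partial>M01) \<le> exp (l\<^sup>2 * (real p * \<sigma>)\<^sup>2 / 2)" .
qed

text \<open>One term of the cosh series bounds an even power by two exponentials. The growth
  \<open>fact k\<close> is what the exponential series of \<open>S^2\<close> can absorb.\<close>

lemma subgaussian_moment:
  assumes S: "subgaussian \<sigma> S" and \<sigma>: "0 < \<sigma>"
  shows "(\<integral>x. S x ^ (2 * k) \<partial>M01) \<le> fact k * (exp 1 * \<sigma>\<^sup>2) ^ k"
proof (cases "k = 0")
  case False
  have bd: "ess_bounded S" using S by (simp add: subgaussian_def)
  \<comment> \<open>This l minimises
    \<open>exp (l^2 * \<sigma>^2 / 2) / l ^ (2 * k)\<close>.\<close>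
  define l where "l = sqrt (2 * real k) / \<sigma>"
  have l: "l > 0" "l\<^sup>2 * \<sigma>\<^sup>2 = 2 * k" using \<sigma> False by (auto simp: l_def power_divide)
  define C where "C = fact (2 * k) / l ^ (2 * k) / 2"
  have C: "0 < C" using l by (simp add: C_def)
  have ptw: "S x ^ (2 * k) \<le> C * exp (l * S x) + C * exp ((-l) * S x)" for x
  proof -
    have "(l * S x) ^ (2 * k) / fact (2 * k) \<le> cosh (l * S x)"
      using cosh_series_partial_le[of "{2 * k}" "l * S x"] by (simp add: divide_inverse mult.commute)
    then have "l ^ (2 * k) * S x ^ (2 * k) \<le> fact (2 * k) * cosh (l * S x)"
      by (simp add: power_mult_distrib divide_le_eq mult.commute)
    then have "S x ^ (2 * k) \<le> fact (2 * k) * cosh (l * S x) / l ^ (2 * k)"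
      using l by (simp add: le_divide_eq mult.commute)
    also have "\<dots> = C * exp (l * S x) + C * exp ((-l) * S x)"
      by (simp add: C_def cosh_field_def distrib_left add_divide_distrib)
    finally show ?thesis .
  qed
  have I: "integrable M01 (\<lambda>x. C * exp (c * S x))" for c
    by (intro ess_bounded_integrable ess_bounded_intros bd)
  have "(\<integral>x. S x ^ (2 * k) \<partial>M01) \<le> (\<integral>x. C * exp (l * S x) + C * exp ((-l) * S x) \<partial>M01)"
    by (intro integral_mono ptw Bochner_Integration.integrable_add I
         ess_bounded_integrable[OF ess_bounded_power[OF bd]])
  also have "\<dots> = C * (\<integral>x. exp (l * S x) \<partial>M01) + C * (\<integral>x. exp ((-l) * S x) \<partial>M01)"
    by (simp only: Bochner_Integration.integral_add[OF I I] integral_mult_right_zero)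
  also have "\<dots> \<le> C * exp (l\<^sup>2 * \<sigma>\<^sup>2 / 2) + C * exp ((-l)\<^sup>2 * \<sigma>\<^sup>2 / 2)"
  proof -
    have "(\<integral>x. exp (c * S x) \<partial>M01) \<le> exp (c\<^sup>2 * \<sigma>\<^sup>2 / 2)" for c
      using S unfolding subgaussian_def by blast
    from this[of l] this[of "-l"] show ?thesis
      using C by (intro mult_left_mono add_mono) auto
  qed
  also have "\<dots> = (fact (2 * k) / l ^ (2 * k)) * exp (real k)"
    using l(2) by (simp add: C_def)
  also have "\<dots> = fact (2 * k) / (2 * real k) ^ k * (exp 1 * \<sigma>\<^sup>2) ^ k"
  proof -
    have "l ^ (2 * k) * (\<sigma>\<^sup>2) ^ k = (l\<^sup>2 * \<sigma>\<^sup>2) ^ k"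
      by (simp add: power_mult power_mult_distrib)
    then have "l ^ (2 * k) * (\<sigma>\<^sup>2) ^ k = (2 * real k) ^ k" unfolding l(2) by simp
    then have "l ^ (2 * k) = (2 * real k) ^ k / (\<sigma>\<^sup>2) ^ k"
      using \<sigma> by (simp add: field_simps)
    moreover have "exp (real k) = exp 1 ^ k" by (simp flip: exp_of_nat_mult)
    ultimately show ?thesis by (simp add: power_mult_distrib)
  qed
  also have "\<dots> \<le> fact k * (exp 1 * \<sigma>\<^sup>2) ^ k"
  proof -
    \<comment> \<open>Only the upper k factors of \<open>fact (2 * k)\<close> are estimated, each by
      \<open>2 * k\<close>, so that \<open>fact k\<close> survives.\<close>
    have "fact (2 * k) div fact (2 * k - k) \<le> (2 * k) ^ k"
      by (rule fact_div_fact_le_pow) simp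
    moreover have "(fact k :: nat) dvd fact (2 * k)" by (rule fact_dvd) simp
    ultimately have "fact (2 * k) \<le> fact k * (2 * k) ^ k"
      by (metis diff_add_inverse dvd_mult_div_cancel mult_2 mult_le_mono2)
    then have "real (fact (2 * k)) \<le> real (fact k * (2 * k) ^ k)"
      by (simp only: of_nat_le_iff)
    then have "fact (2 * k) / (2 * real k) ^ k \<le> fact k"
      using False by (simp add: field_simps)
    then show ?thesis using \<sigma> by (intro mult_right_mono) auto
  qed
  finally show ?thesis .
qed simp

text \<open>In the power series of \<open>exp (S^2 / c^2) - 1\<close> the factorials cancel against
  the moments and leave powers of \<open>exp 1 * \<sigma>^2 / c^2\<close>. For
  \<open>c^2 = 2 * exp 1 * \<sigma>^2\<close> this ratio is 1/2, and the series, starting at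
  exponent 1, sums to 1.\<close>

lemma subgaussian_orlicz:
  assumes S: "subgaussian \<sigma> S" and \<sigma>: "0 < \<sigma>"
  shows "(\<integral>\<^sup>+ x. ennreal (exp ((\<bar>S x\<bar> / (sqrt (2 * exp 1) * \<sigma>))\<^sup>2) - 1) \<partial>M01) \<le> 1"
proof -
  have bd: "ess_bounded S" using S by (simp add: subgaussian_def)
  then have [measurable]: "S \<in> borel_measurable M01" by (rule ess_boundedD)
  let ?c = "2 * exp 1 * \<sigma>\<^sup>2"
  have sq: "(\<bar>S x\<bar> / (sqrt (2 * exp 1) * \<sigma>))\<^sup>2 = (S x)\<^sup>2 / ?c" for x
    by (simp add: power_divide power_mult_distrib)
  define g where "g k x = ((S x)\<^sup>2 / ?c) ^ Suc k /\<^sub>R fact (Suc k)" for k x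
  have g: "ennreal (exp ((\<bar>S x\<bar> / (sqrt (2 * exp 1) * \<sigma>))\<^sup>2) - 1) = (\<Sum>k. ennreal (g k x))" for x
  proof -
    have "(\<lambda>k. ((S x)\<^sup>2 / ?c) ^ k /\<^sub>R fact k) sums exp ((S x)\<^sup>2 / ?c)"
      by (rule exp_converges)
    then have "(\<lambda>k. g k x) sums (exp ((S x)\<^sup>2 / ?c) - 1)"
      unfolding g_def by (subst sums_Suc_iff) simp
    then show ?thesis
      unfolding sq by (intro suminf_ennreal_eq[symmetric]) (auto simp: g_def)
  qed
  have g_int: "(\<integral>\<^sup>+ x. ennreal (g k x) \<partial>M01) \<le> ennreal ((1/2) ^ Suc k)" for k
  proof -
    have gk: "g k x = inverse (fact (Suc k) * ?c ^ Suc k) * S x ^ (2 * Suc k)" for x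
      by (simp only: g_def power_divide power_mult) (simp add: field_simps)
    have "ess_bounded (g k)"
      unfolding gk[abs_def] using bd by (intro ess_bounded_intros)
    then have "integrable M01 (g k)" by (rule ess_bounded_integrable)
    then have "(\<integral>\<^sup>+ x. ennreal (g k x) \<partial>M01) = ennreal (\<integral>x. g k x \<partial>M01)"
      by (rule nn_integral_eq_integral) (auto simp: g_def)
    also have "(\<integral>x. g k x \<partial>M01) = inverse (fact (Suc k) * ?c ^ Suc k) * (\<integral>x. S x ^ (2 * Suc k) \<partial>M01)"
      unfolding gk by simp
    also have "\<dots> \<le> inverse (fact (Suc k) * ?c ^ Suc k) * (fact (Suc k) * (exp 1 * \<sigma>\<^sup>2) ^ Suc k)"
      by (intro mult_left_mono subgaussian_moment S \<sigma>) auto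
    also have "\<dots> = ((exp 1 * \<sigma>\<^sup>2) / ?c) ^ Suc k"
      unfolding power_divide by (simp add: field_simps del: power_Suc fact_Suc)
    also have "(exp 1 * \<sigma>\<^sup>2) / ?c = 1 / 2" using \<sigma> by simp
    finally show ?thesis by (simp add: ennreal_leI)
  qed
  have "(\<integral>\<^sup>+ x. ennreal (exp ((\<bar>S x\<bar> / (sqrt (2 * exp 1) * \<sigma>))\<^sup>2) - 1) \<partial>M01)
      = (\<Sum>k. \<integral>\<^sup>+ x. ennreal (g k x) \<partial>M01)"
    unfolding g by (intro nn_integral_suminf) (auto simp: g_def)
  also have "\<dots> \<le> (\<Sum>k. ennreal ((1/2) ^ Suc k))"
    by (intro suminf_le g_int) auto
  also have "\<dots> = ennreal 1"
    by (intro suminf_ennreal_eq power_half_series) auto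
  finally show ?thesis by simp
qed

section \<open>Lacunary index sequences\<close>

lemma lacunary_pos:
  assumes "lacunary q n" "q > 1" shows "0 < n k"
proof (rule ccontr)
  assume "\<not> 0 < n k"
  \<comment> \<open>Division by zero yields 0, so the quotient condition fails after a vanishing
    index.\<close>
  then have "real (n (Suc k)) / real (n k) = 0" by simp
  then show False using assms unfolding lacunary_def by (metis not_less zero_le_one order_trans less_imp_le)
qed

lemma lacunary_growth:
  assumes "lacunary q n" "q > 1" shows "q ^ p * n k \<le> n (k + p)"
proof (induction p)
  case (Suc p)
  have "q * n (k + p) \<le> n (Suc (k + p))"
    using assms lacunary_pos[OF assms, of "k + p"] by (simp add: lacunary_def le_divide_eq)
  moreover have "q * (q ^ p * n k) \<le> q * n (k + p)"
    using assms Suc by (intro mult_left_mono) auto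
  ultimately show ?case by (simp add: mult.assoc)
qed simp

lemma lacunary_inj:
  assumes "lacunary q n" "q > 1" shows "inj n"
proof -
  have "n k < n (Suc k)" for k
  proof -
    have "real (n k) < q * n k" using assms lacunary_pos[OF assms, of k] by simp
    also have "\<dots> \<le> n (Suc k)" using lacunary_growth[OF assms, of 1 k] by simp
    finally show ?thesis by simp
  qed
  then show ?thesis by (simp add: strict_mono_Suc_iff strict_mono_imp_inj_on)
qed

lemma power2_between:
  assumes "0 < (n::nat)" obtains t where "n < 2 ^ t" "2 ^ t \<le> 2 * n"
proof -
  define t where "t = (LEAST t. n < 2 ^ t)"
  have t: "n < 2 ^ t" unfolding t_def by (rule LeastI[of _ n]) (rule less_exp)
  moreover have "t \<noteq> 0" using t assms by (intro notI) simp
  then obtain u where u: "t = Suc u" by (cases t) auto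
  have "\<not> n < 2 ^ u" using not_less_Least[of u "\<lambda>t. n < 2 ^ t"] u t_def by simp
  then have "2 ^ t \<le> 2 * n" using u by simp
  ultimately show ?thesis using that by blast
qed

text \<open>After p steps the index has at least doubled, and between a positive integer (excluded)
  and its double (included) there is always a power of two.\<close>

lemma lacunary_progression_dyadic_separated:
  assumes n: "lacunary q n" "q > 1" and p: "2 \<le> q ^ p"
  shows "dyadic_separated (\<lambda>i. n (i * p + r))"
  unfolding dyadic_separated_def
proof (intro conjI allI)
  show "0 < n (0 * p + r)" by (rule lacunary_pos[OF n])
  fix i
  obtain t where t: "n (i * p + r) < 2 ^ t" "2 ^ t \<le> 2 * n (i * p + r)"
    using power2_between lacunary_pos[OF n] by metis
  have "2 * real (n (i * p + r)) \<le> q ^ p * n (i * p + r)"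
    using p by (intro mult_right_mono) auto
  also have "\<dots> \<le> n (i * p + r + p)" by (rule lacunary_growth[OF n])
  finally have "2 * n (i * p + r) \<le> n (Suc i * p + r)" by (simp add: algebra_simps)
  then show "\<exists>t. n (i * p + r) < 2 ^ t \<and> 2 ^ t \<le> n (Suc i * p + r)"
    using t by (meson order_trans)
qed

text \<open>An arithmetic progression of step \<open>p\<close> with \<open>q\<^sup>p \<ge> 2\<close> meets every dyadic block at
  most once, so a lacunary sum is a sum of \<open>p\<close> sums of independent signs.\<close>
lemma lacunary_subgaussian:
  assumes "q > 1"
  obtains \<rho> :: real where "0 < \<rho>" "\<And>n a K. lacunary q n \<Longrightarrow>
    subgaussian (\<rho> * sqrt (\<Sum>k<K. (a k)\<^sup>2)) (\<lambda>x. \<Sum>k<K. a k * walsh (n k) x)"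
proof -
  obtain p where p2: "2 < q ^ p" using real_arch_pow[OF assms] by blast
  have p: "0 < p" using p2 by (cases p) auto
  have "subgaussian (real p * sqrt (\<Sum>k<K. (a k)\<^sup>2)) (\<lambda>x. \<Sum>k<K. a k * walsh (n k) x)"
    if n: "lacunary q n" for n a K
  proof -
    define b where "b k = (if k < K then a k else 0)" for k
    have group: "(\<Sum>k<K. f k) = (\<Sum>r<p. \<Sum>i<K. if i * p + r < K then f (i * p + r) else 0)" for f :: "nat \<Rightarrow> real"
    proof -
      \<comment> \<open>K full blocks of length p cover all indices below K; the surplus is padded
        with 0.\<close>
      have le: "K \<le> K * p" using p by simp
      have "(\<Sum>k<K. f k) = (\<Sum>k<K * p. if k < K then f k else 0)"
        using le by (intro sum.mono_neutral_cong_left) auto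
      also have "\<dots> = (\<Sum>i<K. \<Sum>k = i * p..<i * p + p. if k < K then f k else 0)"
        by (rule sum.nat_group[symmetric])
      also have "\<dots> = (\<Sum>i<K. \<Sum>r<p. if i * p + r < K then f (i * p + r) else 0)"
      proof (rule sum.cong[OF refl])
        fix i
        show "(\<Sum>k = i * p..<i * p + p. if k < K then f k else 0)
            = (\<Sum>r<p. if i * p + r < K then f (i * p + r) else 0)"
          by (rule sum.reindex_bij_witness[of _ "\<lambda>r. i * p + r" "\<lambda>k. k - i * p"]) auto
      qed
      finally show ?thesis by (simp only: sum.swap[of _ "{..<K}" "{..<p}"])
    qed
    have "subgaussian (sqrt (\<Sum>k<K. (a k)\<^sup>2)) (\<lambda>x. \<Sum>i<K. b (i * p + r) * walsh (n (i * p + r)) x)"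
      if "r < p" for r
    proof (rule subgaussian_mono)
      show "subgaussian (sqrt (\<Sum>i<K. (b (i * p + r))\<^sup>2)) (\<lambda>x. \<Sum>i<K. b (i * p + r) * walsh (n (i * p + r)) x)"
        using p2 by (intro subgaussian_dyadic_separated lacunary_progression_dyadic_separated[OF n assms]) simp
      have "(\<Sum>i<K. (b (i * p + r))\<^sup>2) \<le> (\<Sum>r<p. \<Sum>i<K. (b (i * p + r))\<^sup>2)"
        using that by (intro member_le_sum[where f = "\<lambda>r. \<Sum>i<K. (b (i * p + r))\<^sup>2"]) (auto intro: sum_nonneg)
      also have "\<dots> = (\<Sum>k<K. (a k)\<^sup>2)"
        unfolding group[of "\<lambda>k. (a k)\<^sup>2"] by (intro sum.cong) (auto simp: b_def)
      finally show "sqrt (\<Sum>i<K. (b (i * p + r))\<^sup>2) \<le> sqrt (\<Sum>k<K. (a k)\<^sup>2)" by simp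
    qed (auto intro: sum_nonneg)
    from subgaussian_sum[OF p this] show ?thesis
      by (simp add: group[of "\<lambda>k. a k * walsh (n k) x" for x] b_def if_distrib[of "\<lambda>c. c * d" for d] cong: if_cong)
  qed
  then show ?thesis using that[of "real p"] p by simp
qed

lemma integral_walsh_sum_square:
  fixes n :: "nat \<Rightarrow> nat" and a :: "nat \<Rightarrow> real"
  assumes "inj n"
  shows "(\<integral>x. (\<Sum>k<K. a k * walsh (n k) x)\<^sup>2 \<partial>M01) = (\<Sum>k<K. (a k)\<^sup>2)"
proof -
  have "(\<integral>x. (\<Sum>k<K. a k * walsh (n k) x)\<^sup>2 \<partial>M01)
      = (\<integral>x. (\<Sum>i<K. \<Sum>j<K. (a i * a j) * walsh (xor (n i) (n j)) x) \<partial>M01)"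
  proof (rule integral_cong_AE)
    show "AE x in M01. (\<Sum>k<K. a k * walsh (n k) x)\<^sup>2
        = (\<Sum>i<K. \<Sum>j<K. (a i * a j) * walsh (xor (n i) (n j)) x)"
      using AE_walsh_mult
      by eventually_elim (simp add: power2_eq_square sum_product algebra_simps)
  qed measurable
  also have "\<dots> = (\<Sum>i<K. \<Sum>j<K. (a i * a j) * (\<integral>x. walsh (xor (n i) (n j)) x \<partial>M01))"
    by (simp add: ess_bounded_integrable)
  also have "\<dots> = (\<Sum>i<K. \<Sum>j<K. if j = i then (a i)\<^sup>2 else 0)"
  proof (intro sum.cong refl)
    fix i j
    have "xor (n i) (n j) = 0 \<longleftrightarrow> i = j"
      using injD[OF assms, of i j] by (metis xor.assoc xor.left_neutral xor.right_neutral xor_self_eq)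
    then show "(a i * a j) * (\<integral>x. walsh (xor (n i) (n j)) x \<partial>M01) = (if j = i then (a i)\<^sup>2 else 0)"
      by (auto simp: integral_walsh power2_eq_square)
  qed
  also have "\<dots> = (\<Sum>k<K. (a k)\<^sup>2)" by simp
  finally show ?thesis .
qed

text \<open>The fourth moment of a lacunary sum is controlled by its second moment, so the sum
  cannot be small outside a set of small measure.\<close>
lemma lacunary_large_set:
  assumes "q > 1"
  obtains \<delta> :: real where "0 < \<delta>" "\<And>n a K. lacunary q n \<Longrightarrow> 0 < (\<Sum>k<K. (a k)\<^sup>2) \<Longrightarrow>
    \<delta> \<le> measure M01 {x \<in> {0..1}. sqrt (\<Sum>k<K. (a k)\<^sup>2) / 2 < \<bar>\<Sum>k<K. a k * walsh (n k) x\<bar>}"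
proof -
  obtain \<rho> where \<rho>: "0 < \<rho>" "\<And>n a K. lacunary q n \<Longrightarrow>
    subgaussian (\<rho> * sqrt (\<Sum>k<K. (a k)\<^sup>2)) (\<lambda>x. \<Sum>k<K. a k * walsh (n k) x)"
    using lacunary_subgaussian[OF assms] by blast
  \<comment> \<open>Paley-Zygmund is applied to the square of the sum, with mean s and second moment
    at most \<open>2 * (exp 1 * \<rho>^2)^2 * s^2\<close>; s cancels in the resulting
    quotient.\<close>
  define \<delta> where "\<delta> = 1 / (8 * (exp 1 * \<rho>\<^sup>2)\<^sup>2)"
  have "\<delta> \<le> measure M01 {x \<in> {0..1}. sqrt (\<Sum>k<K. (a k)\<^sup>2) / 2 < \<bar>\<Sum>k<K. a k * walsh (n k) x\<bar>}"
    if n: "lacunary q n" and s: "0 < (\<Sum>k<K. (a k)\<^sup>2)" for n a K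
  proof -
    define s where "s = (\<Sum>k<K. (a k)\<^sup>2)"
    define S where "S x = (\<Sum>k<K. a k * walsh (n k) x)" for x
    have spos: "0 < s" using s by (simp add: s_def)
    have sub: "subgaussian (\<rho> * sqrt s) S" unfolding s_def S_def using \<rho>(2)[OF n] .
    have bd: "ess_bounded S" using sub by (simp add: subgaussian_def)
    have int: "(\<integral>x. (S x)\<^sup>2 \<partial>M01) = s"
      unfolding S_def s_def by (rule integral_walsh_sum_square[OF lacunary_inj[OF n assms]])
    have "(\<integral>x. S x ^ (2 * 2) \<partial>M01) \<le> fact 2 * (exp 1 * (\<rho> * sqrt s)\<^sup>2) ^ 2"
      using \<rho> spos by (intro subgaussian_moment sub) auto
    also have "\<dots> = 2 * (exp 1 * \<rho>\<^sup>2)\<^sup>2 * s\<^sup>2"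
      using spos by (simp add: power_mult_distrib mult.assoc)
    finally have int4: "(\<integral>x. ((S x)\<^sup>2)\<^sup>2 \<partial>M01) \<le> 2 * (exp 1 * \<rho>\<^sup>2)\<^sup>2 * s\<^sup>2"
      by simp
    have "\<delta> = s\<^sup>2 / (4 * (2 * (exp 1 * \<rho>\<^sup>2)\<^sup>2 * s\<^sup>2))"
      using spos by (simp add: \<delta>_def field_simps)
    also have "\<dots> \<le> measure M01 {x \<in> {0..1}. s / 2 < (S x)\<^sup>2}"
      using spos int by (intro paley_zygmund int4 ess_bounded_power bd) auto
    also have "\<dots> \<le> measure M01 {x \<in> {0..1}. sqrt s / 2 < \<bar>S x\<bar>}"
    proof (rule M01.finite_measure_mono)
      show "{x \<in> {0..1}. s / 2 < (S x)\<^sup>2} \<subseteq> {x \<in> {0..1}. sqrt s / 2 < \<bar>S x\<bar>}"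
      proof safe
        fix x assume x: "s / 2 < (S x)\<^sup>2"
        have "(sqrt s / 2)\<^sup>2 < \<bar>S x\<bar>\<^sup>2" using x spos by (simp add: power_divide)
        then show "sqrt s / 2 < \<bar>S x\<bar>" by (rule power_less_imp_less_base) simp
      qed
      have "{x \<in> space M01. sqrt s / 2 < \<bar>S x\<bar>} \<in> sets M01" using ess_boundedD[OF bd] by measurable
      then show "{x \<in> {0..1}. sqrt s / 2 < \<bar>S x\<bar>} \<in> sets M01" by simp
    qed
    finally show ?thesis by (simp add: s_def S_def)
  qed
  moreover have "0 < \<delta>" using \<rho> by (simp add: \<delta>_def)
  ultimately show ?thesis using that by blast
qed

text \<open>Paley-Zygmund applied to \<open>exp (l * g)\<close> with \<open>l\<close> of order \<open>s\<close> gives the lower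
  Gaussian tail.\<close>
lemma dyadic_separated_lower_tail:
  assumes m: "dyadic_separated m" and s: "3 / 8 \<le> s" "32 * s\<^sup>2 \<le> real n"
  shows "exp (- (128 * s\<^sup>2)) / 4 \<le> measure M01 {x \<in> {0..1}. s < (\<Sum>i<n. 1 / sqrt n * walsh (m i) x)}"
proof -
  define S where "S x = (\<Sum>i<n. 1 / sqrt n * walsh (m i) x)" for x
  define l where "l = 8 * s"
  have bd: "ess_bounded S" unfolding S_def by (auto intro!: ess_bounded_intros simp: divide_inverse)
  have "0 < s\<^sup>2" using s by simp
  then have n: "0 < real n" using s by linarith
  have mgf: "(\<integral>x. exp (c * S x) \<partial>M01) = cosh (c / sqrt n) ^ n" for c
  proof -
    have "c * S x = (\<Sum>i<n. c / sqrt n * walsh (m i) x)" for x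
      by (simp add: S_def sum_distrib_left)
    then show ?thesis using integral_exp_dyadic_separated[OF m, where n = n and a = "\<lambda>_. c / sqrt n"] by simp
  qed
  have lower: "exp (l\<^sup>2 / 4) \<le> (\<integral>x. exp (l * S x) \<partial>M01)"
  proof -
    have "(l / sqrt n)\<^sup>2 = l\<^sup>2 / n" by (simp add: power_divide)
    \<comment> \<open>The assumption \<open>32 * s^2 <= n\<close> places \<open>l / sqrt n\<close>
      in the range where the Gaussian minorant of cosh is valid.\<close>
    moreover have "l\<^sup>2 / n \<le> 2" using s n by (simp add: l_def power_mult_distrib divide_le_eq)
    ultimately have "exp (l\<^sup>2 / n / 4) \<le> cosh (l / sqrt n)" using cosh_ge_exp[of "l / sqrt n"] by simp
    then have "exp (l\<^sup>2 / n / 4) ^ n \<le> cosh (l / sqrt n) ^ n" by (intro power_mono) auto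
    moreover have "exp (l\<^sup>2 / n / 4) ^ n = exp (l\<^sup>2 / 4)" using n by (simp flip: exp_of_nat_mult)
    ultimately show ?thesis by (simp add: mgf)
  qed
  have upper: "(\<integral>x. (exp (l * S x))\<^sup>2 \<partial>M01) \<le> exp (2 * l\<^sup>2)"
  proof -
    have "(\<integral>x. (exp (l * S x))\<^sup>2 \<partial>M01) = cosh (2 * l / sqrt n) ^ n"
      using mgf[of "2 * l"] by (simp add: mult.assoc exp_double)
    also have "\<dots> \<le> exp ((2 * l / sqrt n)\<^sup>2 / 2) ^ n"
      by (intro power_mono cosh_le_exp) simp
    also have "\<dots> = exp (2 * l\<^sup>2)"
      using n by (simp add: power_divide power_mult_distrib flip: exp_of_nat_mult)
    finally show ?thesis .
  qed
  \<comment> \<open>The exact exponent is \<open>l^2 / 2 - 2 * l^2 = -96 * s^2\<close>; 128 is a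
    rounded value.\<close>
  have "exp (- (128 * s\<^sup>2)) / 4 \<le> (exp (l\<^sup>2 / 4))\<^sup>2 / (4 * exp (2 * l\<^sup>2))"
    by (simp add: l_def power_mult_distrib divide_simps exp_minus flip: exp_double exp_add)
  also have "\<dots> \<le> measure M01 {x \<in> {0..1}. exp (l\<^sup>2 / 4) / 2 < exp (l * S x)}"
    by (intro paley_zygmund lower upper ess_bounded_intros bd) auto
  also have "\<dots> \<le> measure M01 {x \<in> {0..1}. s < S x}"
  proof (rule M01.finite_measure_mono)
    show "{x \<in> {0..1}. exp (l\<^sup>2 / 4) / 2 < exp (l * S x)} \<subseteq> {x \<in> {0..1}. s < S x}"
    proof safe
      fix x assume x: "exp (l\<^sup>2 / 4) / 2 < exp (l * S x)"
      have "exp (1::real) \<ge> 2" using exp_ge_add_one_self[of 1] by simp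
      then have "exp (l\<^sup>2 / 4) / exp 1 \<le> exp (l\<^sup>2 / 4) / 2" by (intro divide_left_mono) auto
      then have "exp (l\<^sup>2 / 4 - 1) < exp (l * S x)"
        unfolding exp_diff using x by linarith
      then have "l\<^sup>2 / 4 - 1 < l * S x" by simp
      \<comment> \<open>For \<open>l = 8 * s\<close> this says \<open>8 * s^2 >= 1\<close>, which
        \<open>s >= 3/8\<close> guarantees. The 1 comes from replacing the factor 1/2 in the
        threshold by \<open>exp (-1)\<close>.\<close>
      moreover have "l * s \<le> l\<^sup>2 / 4 - 1"
      proof -
        have "(3/8)\<^sup>2 \<le> s\<^sup>2" using s by (intro power_mono) auto
        then show ?thesis by (simp add: l_def power2_eq_square)
      qed
      ultimately have "l * s < l * S x" by linarith
      then show "s < S x" using s by (simp add: l_def)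
    qed
    have "{x \<in> space M01. s < S x} \<in> sets M01" using ess_boundedD[OF bd] by measurable
    then show "{x \<in> {0..1}. s < S x} \<in> sets M01" by simp
  qed
  finally show ?thesis by (simp add: S_def)
qed

subsection \<open>Rearrangement invariant norms\<close>

definition distr_fun :: "(real \<Rightarrow> real) \<Rightarrow> real \<Rightarrow> real" where
  "distr_fun f s = measure M01 {x \<in> {0..1}. s < \<bar>f x\<bar>}"

text \<open>The decreasing rearrangement as a supremum of levels; \<open>insert 0\<close> supplies
  the value 0 where no level qualifies. Thanks to the strict inequality, for bounded f and s \<ge> 0
  the set where \<open>rearr f\<close> exceeds s is a half-open interval from 0 of length exactly
  \<open>distr_fun f s\<close>.\<close>

definition rearr :: "(real \<Rightarrow> real) \<Rightarrow> real \<Rightarrow> real" where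
  "rearr f t = Sup (insert 0 {s. 0 \<le> s \<and> t < distr_fun f s})"

lemma level_set_measurable:
  fixes f :: "real \<Rightarrow> real"
  assumes "f \<in> borel_measurable M01" shows "{x \<in> {0..1}. s < \<bar>f x\<bar>} \<in> sets M01"
proof -
  have "{x \<in> space M01. s < \<bar>f x\<bar>} \<in> sets M01"
    using assms by measurable
  then show ?thesis by simp
qed

lemma distr_fun_antimono:
  assumes "f \<in> borel_measurable M01" "s \<le> u" shows "distr_fun f u \<le> distr_fun f s"
  unfolding distr_fun_def
  by (intro M01.finite_measure_mono level_set_measurable assms(1)) (use assms(2) in auto)

text \<open>Continuity from below of the measure along the sets where \<open>|f|\<close> exceeds
  \<open>s + 1 / (i + 1)\<close>. The room above s is what yields a strict inequality in
  \<open>less_rearr_iff\<close>.\<close>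

lemma distr_fun_right_cont:
  assumes f: "f \<in> borel_measurable M01" and t: "t < distr_fun f s"
  obtains u where "s < u" "t < distr_fun f u"
proof -
  let ?A = "\<lambda>i. {x \<in> {0..1}. s + 1 / real (Suc i) < \<bar>f x\<bar>}"
  have "incseq ?A"
  proof (rule incseq_SucI, safe)
    fix i x assume "s + 1 / real (Suc i) < \<bar>f x\<bar>"
    moreover have "1 / real (Suc (Suc i)) \<le> 1 / real (Suc i)" by (simp add: field_simps)
    ultimately show "s + 1 / real (Suc (Suc i)) < \<bar>f x\<bar>" by linarith
  qed
  then have "(\<lambda>i. measure M01 (?A i)) \<longlonglongrightarrow> measure M01 (\<Union>i. ?A i)"
    by (intro M01.finite_Lim_measure_incseq) (use level_set_measurable[OF f] in auto)
  also have "(\<Union>i. ?A i) = {x \<in> {0..1}. s < \<bar>f x\<bar>}"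
  proof safe
    fix i x assume "s + 1 / real (Suc i) < \<bar>f x\<bar>"
    moreover have "0 < 1 / real (Suc i)" by simp
    ultimately show "s < \<bar>f x\<bar>" by linarith
  next
    fix x :: real assume x: "x \<in> {0..1}" "s < \<bar>f x\<bar>"
    obtain i where "inverse (real (Suc i)) < \<bar>f x\<bar> - s" using reals_Archimedean[of "\<bar>f x\<bar> - s"] x by auto
    then show "x \<in> (\<Union>i. ?A i)" using x by (auto simp: inverse_eq_divide intro!: exI[of _ i])
  qed
  finally have "(\<lambda>i. distr_fun f (s + 1 / real (Suc i))) \<longlonglongrightarrow> distr_fun f s"
    by (simp add: distr_fun_def)
  then have "eventually (\<lambda>i. t < distr_fun f (s + 1 / real (Suc i))) sequentially"
    using t by (rule order_tendstoD)
  then obtain i where "t < distr_fun f (s + 1 / real (Suc i))"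
    by (auto simp: eventually_sequentially)
  moreover have "s < s + 1 / real (Suc i)" by simp
  ultimately show ?thesis using that by blast
qed

lemma rearr_bdd_above:
  assumes f: "ess_bounded f" and t: "0 \<le> t"
  shows "bdd_above (insert 0 {s. 0 \<le> s \<and> t < distr_fun f s})"
proof -
  obtain B where B: "AE x in M01. \<bar>f x\<bar> \<le> B" using f by (auto simp: ess_bounded_def)
  have "s \<le> \<bar>B\<bar>" if "t < distr_fun f s" for s
  proof (rule ccontr)
    assume s: "\<not> s \<le> \<bar>B\<bar>"
    have "AE x in M01. \<not> (s < \<bar>f x\<bar>)" using B by eventually_elim (use s in auto)
    then have "{x \<in> {0..1}. s < \<bar>f x\<bar>} \<in> null_sets M01"
      using level_set_measurable[OF ess_boundedD[OF f], of s] AE_iff_null[of M01 "\<lambda>x. \<not> s < \<bar>f x\<bar>"] by simp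
    then have "distr_fun f s = 0" by (simp add: distr_fun_def measure_eq_0_null_sets)
    then show False using that t by simp
  qed
  then show ?thesis by (intro bdd_aboveI[of _ "\<bar>B\<bar>"]) auto
qed

lemma rearr_nonneg: "ess_bounded f \<Longrightarrow> 0 \<le> t \<Longrightarrow> 0 \<le> rearr f t"
  unfolding rearr_def by (rule cSup_upper[OF insertI1 rearr_bdd_above])

lemma less_rearr_iff:
  assumes f: "ess_bounded f" and "0 \<le> s" "0 \<le> t"
  shows "s < rearr f t \<longleftrightarrow> t < distr_fun f s"
proof
  assume "t < distr_fun f s"
  then obtain u where u: "s < u" "t < distr_fun f u"
    using distr_fun_right_cont[OF ess_boundedD[OF f]] by blast
  then have "u \<le> rearr f t"
    unfolding rearr_def using assms by (intro cSup_upper rearr_bdd_above) auto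
  then show "s < rearr f t" using u by simp
next
  assume "s < rearr f t"
  then obtain u where "u \<in> insert 0 {s. 0 \<le> s \<and> t < distr_fun f s}" "s < u"
    unfolding rearr_def using less_cSup_iff[OF _ rearr_bdd_above[OF f \<open>0 \<le> t\<close>]] by blast
  then show "t < distr_fun f s"
    using assms distr_fun_antimono[OF ess_boundedD[OF f], of s u] by auto
qed

lemma rearr_level_set:
  assumes f: "ess_bounded f"
  shows "{x \<in> {0..1}. s < rearr f x} = (if s < 0 then {0..1} else {0..<distr_fun f s})"
proof (cases "s < 0")
  case True
  then show ?thesis using rearr_nonneg[OF f] by force
next
  case False
  have "distr_fun f s \<le> 1"
    unfolding distr_fun_def using M01.bounded_measure by simp
  then show ?thesis using False less_rearr_iff[OF f] by auto
qed

lemma Ico_in_sets_M01: "d \<le> 1 \<Longrightarrow> {0..<d} \<in> sets M01"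
  unfolding M01_def by (auto simp: sets_restrict_space_iff)

lemma distr_fun_le_1: "distr_fun f s \<le> 1"
  unfolding distr_fun_def using M01.bounded_measure by simp

lemma rearr_measurable: "ess_bounded f \<Longrightarrow> rearr f \<in> borel_measurable M01"
  unfolding borel_measurable_iff_greater
  using rearr_level_set[of f] Ico_in_sets_M01[OF distr_fun_le_1[of f]] sets.top[of M01] by simp

lemma equimeasurable_rearr:
  assumes f: "ess_bounded f" shows "equimeasurable f (rearr f)"
  unfolding equimeasurable_def
proof
  fix t :: real
  have abs: "{x \<in> space M01. t < \<bar>rearr f x\<bar>} = {x \<in> {0..1}. t < rearr f x}"
  proof -
    have "\<bar>rearr f x\<bar> = rearr f x" if "x \<in> {0..1}" for x
      using rearr_nonneg[OF f, of x] that by simp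
    then show ?thesis unfolding space_M01 by (intro Collect_cong conj_cong refl) (simp only:)
  qed
  show "emeasure M01 {x \<in> space M01. t < \<bar>f x\<bar>} = emeasure M01 {x \<in> space M01. t < \<bar>rearr f x\<bar>}"
  proof (cases "t < 0")
    case True
    then have "{x \<in> space M01. t < \<bar>f x\<bar>} = {0..1}" by auto
    then show ?thesis unfolding abs rearr_level_set[OF f] using True by simp
  next
    case False
    have "0 \<le> distr_fun f t" by (simp add: distr_fun_def)
    then have "emeasure M01 {0..<distr_fun f t} = ennreal (distr_fun f t)"
      unfolding emeasure_M01[OF Ico_in_sets_M01[OF distr_fun_le_1]] by simp
    also have "\<dots> = emeasure M01 {x \<in> space M01. t < \<bar>f x\<bar>}"
      unfolding distr_fun_def M01.emeasure_eq_measure by simp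
    finally show ?thesis unfolding abs rearr_level_set[OF f] using False by simp
  qed
qed

section \<open>Rules for a rearrangement invariant norm\<close>

lemma in_spaceI: "f \<in> borel_measurable M01 \<Longrightarrow> N f \<le> ennreal c \<Longrightarrow> in_space N f"
  unfolding in_space_def using le_less_trans[OF _ ennreal_less_top] by simp

lemma in_space_measurable: "in_space N f \<Longrightarrow> f \<in> borel_measurable M01"
  by (simp add: in_space_def)

context
  fixes N :: "(real \<Rightarrow> real) \<Rightarrow> ennreal"
  assumes ri: "ri_space N"
begin

lemmas ri_conjuncts = ri [unfolded ri_space_def banach_function_space_def, THEN conjunct1]

lemma N_cong_AE:
  "f \<in> borel_measurable M01 \<Longrightarrow> g \<in> borel_measurable M01 \<Longrightarrow> AE x in M01. f x = g x \<Longrightarrow> N f = N g"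
  by (rule ri_conjuncts[THEN conjunct1, rule_format])

lemma N_zero: "N (\<lambda>_. 0) = 0"
  using ri_conjuncts[THEN conjunct2, THEN conjunct1] .

lemma N_triangle: "in_space N f \<Longrightarrow> in_space N g \<Longrightarrow> N (\<lambda>x. f x + g x) \<le> N f + N g"
  by (rule ri_conjuncts[THEN conjunct2, THEN conjunct2, THEN conjunct1, rule_format])

lemma N_scale: "in_space N f \<Longrightarrow> N (\<lambda>x. c * f x) = ennreal \<bar>c\<bar> * N f"
  by (rule ri_conjuncts[THEN conjunct2, THEN conjunct2, THEN conjunct2, THEN conjunct1, rule_format])

lemma N_eq_0D: "in_space N f \<Longrightarrow> N f = 0 \<Longrightarrow> AE x in M01. f x = 0"
  by (rule ri_conjuncts[THEN conjunct2, THEN conjunct2, THEN conjunct2, THEN conjunct2, THEN conjunct1, rule_format])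

lemma N_mono:
  "in_space N g \<Longrightarrow> f \<in> borel_measurable M01 \<Longrightarrow> AE x in M01. \<bar>f x\<bar> \<le> \<bar>g x\<bar> \<Longrightarrow> N f \<le> N g"
  by (rule ri_conjuncts[THEN conjunct2, THEN conjunct2, THEN conjunct2, THEN conjunct2, THEN conjunct2, THEN conjunct1, rule_format])

lemma N_complete:
  assumes "\<And>m. in_space N (u m)" "\<And>e. e > 0 \<Longrightarrow> \<exists>K. \<forall>m\<ge>K. \<forall>n\<ge>K. N (\<lambda>x. u m x - u n x) < e"
  obtains f where "in_space N f" "(\<lambda>n. N (\<lambda>x. u n x - f x)) \<longlonglongrightarrow> 0"
proof -
  have "\<forall>m. in_space N (u m)" "\<forall>e>0. \<exists>K. \<forall>m\<ge>K. \<forall>n\<ge>K. N (\<lambda>x. u m x - u n x) < e"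
    using assms by blast+
  then have "\<exists>f. in_space N f \<and> (\<lambda>n. N (\<lambda>x. u n x - f x)) \<longlonglongrightarrow> 0"
    using ri_conjuncts[THEN conjunct2, THEN conjunct2, THEN conjunct2, THEN conjunct2, THEN conjunct2, THEN conjunct2,
      THEN spec[of _ u]] by (elim impE)
  then show ?thesis using that by (elim exE conjE)
qed

lemma N_equimeasurable:
  "f \<in> borel_measurable M01 \<Longrightarrow> g \<in> borel_measurable M01 \<Longrightarrow> equimeasurable f g \<Longrightarrow> N f = N g"
  by (rule ri[unfolded ri_space_def, THEN conjunct2, rule_format])

lemma in_space_scale: "in_space N f \<Longrightarrow> in_space N (\<lambda>x. c * f x)"
  using N_scale[of f c] by (auto simp: in_space_def ennreal_mult_less_top)

lemma in_space_add: "in_space N f \<Longrightarrow> in_space N g \<Longrightarrow> in_space N (\<lambda>x. f x + g x)"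
  using N_triangle[of f g] by (auto simp: in_space_def intro: le_less_trans)

lemma in_space_diff: "in_space N f \<Longrightarrow> in_space N g \<Longrightarrow> in_space N (\<lambda>x. f x - g x)"
  using in_space_add[OF _ in_space_scale[of g "-1"], of f] by simp

lemma N_minus_commute:
  "in_space N f \<Longrightarrow> in_space N g \<Longrightarrow> N (\<lambda>x. f x - g x) = N (\<lambda>x. g x - f x)"
  using N_scale[OF in_space_diff, of f g "-1"] by simp

text \<open>Neither function need dominate the other pointwise. Their rearrangements are ordered, so
  the lattice property applies to these, and rearranging preserves the norm.\<close>

lemma N_mono_distr:
  assumes f: "ess_bounded f" and g: "ess_bounded g" "in_space N g"
    and le: "\<And>s. 0 \<le> s \<Longrightarrow> distr_fun f s \<le> distr_fun g s"
  shows "N f \<le> N g"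
proof -
  have eq: "N h = N (rearr h)" if "ess_bounded h" for h
    by (intro N_equimeasurable equimeasurable_rearr rearr_measurable ess_boundedD that)
  have "N (rearr f) \<le> N (rearr g)"
  proof (rule N_mono)
    show "in_space N (rearr g)"
      using g eq[OF g(1)] rearr_measurable[OF g(1)] by (simp add: in_space_def)
    show "rearr f \<in> borel_measurable M01" by (rule rearr_measurable[OF f])
    show "AE x in M01. \<bar>rearr f x\<bar> \<le> \<bar>rearr g x\<bar>"
    proof (rule AE_I2)
      fix x assume "x \<in> space M01"
      then have x: "0 \<le> x" by simp
      have "rearr f x \<le> rearr g x"
        unfolding rearr_def
        by (rule cSup_subset_mono) (use le rearr_bdd_above[OF g(1) x] in \<open>auto intro: less_le_trans\<close>)
      then show "\<bar>rearr f x\<bar> \<le> \<bar>rearr g x\<bar>" using rearr_nonneg[OF f x] by simp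
    qed
  qed
  then show ?thesis using eq[OF f] eq[OF g(1)] by simp
qed

lemma ess_bounded_indicator: "A \<in> sets M01 \<Longrightarrow> ess_bounded (indicator A)"
  by (rule ess_boundedI[of _ 1]) (auto simp: indicator_def)

text \<open>By rearrangement invariance all sets of measure at least \<open>\<delta>\<close> have indicators of norm
  at least that of the indicator of \<open>[0,\<delta>]\<close>.\<close>
lemma N_weak_type:
  assumes "0 < \<delta>"
  obtains \<eta> :: real where "0 < \<eta>" "\<And>h \<epsilon>. in_space N h \<Longrightarrow> 0 \<le> \<epsilon> \<Longrightarrow> \<delta> \<le> distr_fun h \<epsilon> \<Longrightarrow> ennreal (\<epsilon> * \<eta>) \<le> N h"
proof -
  define d where "d = min \<delta> 1"
  have d: "0 < d" "d \<le> 1" "d \<le> \<delta>" using assms by (auto simp: d_def)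
  define e :: "real \<Rightarrow> real" where "e = indicator {0..<d}"
  have e: "ess_bounded e" unfolding e_def by (intro ess_bounded_indicator Ico_in_sets_M01 d)
  have md: "measure M01 {0..<d} = d"
    using emeasure_M01[OF Ico_in_sets_M01[OF d(2)]] d by (simp add: measure_def)
  have "N e \<noteq> 0"
  proof
    assume 0: "N e = 0"
    then have "AE x in M01. e x = 0"
      using ess_boundedD[OF e] by (intro N_eq_0D) (auto simp: in_space_def)
    then have "AE x in M01. x \<notin> {0..<d}"
      by eventually_elim (auto simp: e_def indicator_def split: if_splits)
    then have "measure M01 {0..<d} = 0"
      using Ico_in_sets_M01[OF d(2)] by (simp add: AE_iff_null_sets measure_eq_0_null_sets)
    then show False using md d by simp
  qed
  \<comment> \<open>The indicator e may lie outside X, with \<open>N e\<close> infinite; the cap 1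
    keeps \<open>\<eta>\<close> a positive real.\<close>
  define \<eta> where "\<eta> = enn2real (min 1 (N e))"
  have fin: "min 1 (N e) \<noteq> \<infinity>" by (cases "N e = top") (auto simp: min_def)
  have \<eta>: "0 < \<eta>" "ennreal \<eta> \<le> N e"
    using \<open>N e \<noteq> 0\<close> fin by (auto simp: \<eta>_def enn2real_positive_iff less_top[symmetric] min_def zero_less_iff_neq_zero)
  have "ennreal (\<epsilon> * \<eta>) \<le> N h" if h: "in_space N h" and \<epsilon>: "0 \<le> \<epsilon>" and \<delta>: "\<delta> \<le> distr_fun h \<epsilon>" for h \<epsilon>
  proof (cases "\<epsilon> = 0")
    case False
    define E where "E = {x \<in> {0..1}. \<epsilon> < \<bar>h x\<bar>}"
    have E: "E \<in> sets M01" unfolding E_def by (rule level_set_measurable[OF in_space_measurable[OF h]])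
    define i :: "real \<Rightarrow> real" where "i = indicator E"
    have i: "ess_bounded i" unfolding i_def by (rule ess_bounded_indicator[OF E])
    have le: "N (\<lambda>x. \<epsilon> * i x) \<le> N h"
    proof (rule N_mono[OF h])
      show "(\<lambda>x. \<epsilon> * i x) \<in> borel_measurable M01" using ess_boundedD[OF i] by measurable
      show "AE x in M01. \<bar>\<epsilon> * i x\<bar> \<le> \<bar>h x\<bar>"
        using \<epsilon> by (intro AE_I2) (auto simp: i_def E_def indicator_def)
    qed
    then have "in_space N (\<lambda>x. \<epsilon> * i x)"
      using h ess_boundedD[OF i] by (auto simp: in_space_def intro: le_less_trans)
    from in_space_scale[OF this, of "1 / \<epsilon>"] have ii: "in_space N i" using False by simp
    have "N e \<le> N i"
    proof (rule N_mono_distr[OF e i ii])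
      fix s :: real assume "0 \<le> s"
      show "distr_fun e s \<le> distr_fun i s"
      proof (cases "s < 1")
        case True
        have "{x \<in> {0..1}. s < \<bar>e x\<bar>} = {0..<d}" "{x \<in> {0..1}. s < \<bar>i x\<bar>} = E"
          using True \<open>0 \<le> s\<close> d by (auto simp: e_def i_def E_def indicator_def split: if_splits)
        then show ?thesis using \<delta> d md by (simp add: distr_fun_def E_def)
      next
        case False
        then have "{x \<in> {0..1}. s < \<bar>e x\<bar>} = {}" by (auto simp: e_def indicator_def)
        then show ?thesis by (simp only: distr_fun_def measure_empty measure_nonneg)
      qed
    qed
    have "ennreal (\<epsilon> * \<eta>) = ennreal \<epsilon> * ennreal \<eta>" using \<epsilon> \<eta> by (simp add: ennreal_mult)
    also have "\<dots> \<le> ennreal \<epsilon> * N i" using \<eta> \<open>N e \<le> N i\<close> by (intro mult_left_mono) auto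
    also have "\<dots> = N (\<lambda>x. \<epsilon> * i x)" using N_scale[OF ii, of \<epsilon>] \<epsilon> by simp
    also note le
    finally show ?thesis .
  qed simp
  then show ?thesis using that \<eta>(1) by blast
qed

text \<open>Limits in measure are unique, and both hypotheses imply convergence in measure: the L^2
  one by Chebyshev's inequality, the one in X by \<open>N_weak_type\<close>.\<close>

lemma N_limit_eq_L2_limit:
  assumes u: "\<And>K. in_space N (u K)" and g: "in_space N g" and f: "f \<in> borel_measurable M01"
    and lim: "(\<lambda>K. N (\<lambda>x. u K x - g x)) \<longlonglongrightarrow> 0"
    and lim2: "(\<lambda>K. \<integral>\<^sup>+ x. ennreal ((f x - u K x)\<^sup>2) \<partial>M01) \<longlonglongrightarrow> 0"
  shows "AE x in M01. f x = g x"
proof -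
  note [measurable] = f in_space_measurable[OF g] in_space_measurable[OF u]
  have zero: "distr_fun (\<lambda>x. f x - g x) (2 * \<epsilon>) = 0" if \<epsilon>: "0 < \<epsilon>" for \<epsilon>
  \<comment> \<open>Suppose f and g differ by more than \<open>2 * \<epsilon>\<close> on a set of
    measure \<open>\<delta>\<close>. For a late K, \<open>f - u K\<close> exceeds
    \<open>\<epsilon>\<close> on at most half of that measure, so \<open>u K - g\<close> does so on
    at least the other half, contradicting its small norm.\<close>
  proof (rule ccontr)
    define \<delta> where "\<delta> = distr_fun (\<lambda>x. f x - g x) (2 * \<epsilon>)"
    assume "distr_fun (\<lambda>x. f x - g x) (2 * \<epsilon>) \<noteq> 0"
    then have \<delta>: "0 < \<delta>" by (simp add: \<delta>_def distr_fun_def order.not_eq_order_implies_strict)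
    obtain \<eta> where \<eta>: "0 < \<eta>" "\<And>h \<epsilon>. in_space N h \<Longrightarrow> 0 \<le> \<epsilon> \<Longrightarrow> \<delta> / 2 \<le> distr_fun h \<epsilon> \<Longrightarrow> ennreal (\<epsilon> * \<eta>) \<le> N h"
      using N_weak_type[of "\<delta> / 2"] \<delta> by auto
    have "eventually (\<lambda>K. N (\<lambda>x. u K x - g x) < ennreal (\<epsilon> * \<eta>)) sequentially"
      using \<epsilon> \<eta> by (intro order_tendstoD[OF lim]) auto
    moreover have "eventually (\<lambda>K. (\<integral>\<^sup>+ x. ennreal ((f x - u K x)\<^sup>2) \<partial>M01) < ennreal (\<epsilon>\<^sup>2 * (\<delta> / 2))) sequentially"
      using \<epsilon> \<delta> by (intro order_tendstoD[OF lim2]) auto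
    ultimately have "eventually (\<lambda>K. N (\<lambda>x. u K x - g x) < ennreal (\<epsilon> * \<eta>) \<and>
      (\<integral>\<^sup>+ x. ennreal ((f x - u K x)\<^sup>2) \<partial>M01) < ennreal (\<epsilon>\<^sup>2 * (\<delta> / 2))) sequentially"
      by (rule eventually_conj)
    then obtain K where K: "N (\<lambda>x. u K x - g x) < ennreal (\<epsilon> * \<eta>)"
      "(\<integral>\<^sup>+ x. ennreal ((f x - u K x)\<^sup>2) \<partial>M01) < ennreal (\<epsilon>\<^sup>2 * (\<delta> / 2))"
      by (auto simp: eventually_sequentially)
    have "distr_fun (\<lambda>x. f x - u K x) \<epsilon> \<le> \<delta> / 2"
    proof -
      let ?A = "{x \<in> {0..1}. \<epsilon> < \<bar>f x - u K x\<bar>}"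
      have A: "?A \<in> sets M01" by (rule level_set_measurable) measurable
      have "ennreal (\<epsilon>\<^sup>2) * emeasure M01 ?A = (\<integral>\<^sup>+ x. ennreal (\<epsilon>\<^sup>2) * indicator ?A x \<partial>M01)"
        using A by (simp add: nn_integral_cmult_indicator)
      also have "\<dots> \<le> (\<integral>\<^sup>+ x. ennreal ((f x - u K x)\<^sup>2) \<partial>M01)"
      proof (rule nn_integral_mono)
        fix x
        show "ennreal (\<epsilon>\<^sup>2) * indicator ?A x \<le> ennreal ((f x - u K x)\<^sup>2)"
        proof (cases "x \<in> ?A")
          case True
          then have "\<epsilon>\<^sup>2 \<le> \<bar>f x - u K x\<bar>\<^sup>2" using \<epsilon> by (intro power_mono) auto
          then show ?thesis using True by (simp add: ennreal_leI)
        qed simp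
      qed
      also have "\<dots> \<le> ennreal (\<epsilon>\<^sup>2 * (\<delta> / 2))" using K by simp
      finally have "ennreal (\<epsilon>\<^sup>2 * measure M01 ?A) \<le> ennreal (\<epsilon>\<^sup>2 * (\<delta> / 2))"
        by (simp add: M01.emeasure_eq_measure ennreal_mult)
      then have "\<epsilon>\<^sup>2 * measure M01 ?A \<le> \<epsilon>\<^sup>2 * (\<delta> / 2)"
        using \<delta> by (subst (asm) ennreal_le_iff) auto
      then show ?thesis using \<epsilon> by (simp add: distr_fun_def)
    qed
    moreover have "\<delta> \<le> distr_fun (\<lambda>x. f x - u K x) \<epsilon> + distr_fun (\<lambda>x. u K x - g x) \<epsilon>"
    proof -
      have "\<delta> \<le> measure M01 ({x \<in> {0..1}. \<epsilon> < \<bar>f x - u K x\<bar>} \<union> {x \<in> {0..1}. \<epsilon> < \<bar>u K x - g x\<bar>})"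
        unfolding \<delta>_def distr_fun_def
        by (intro M01.finite_measure_mono sets.Un level_set_measurable) auto
      also have "\<dots> \<le> distr_fun (\<lambda>x. f x - u K x) \<epsilon> + distr_fun (\<lambda>x. u K x - g x) \<epsilon>"
        unfolding distr_fun_def by (intro measure_Un_le level_set_measurable) auto
      finally show ?thesis .
    qed
    ultimately have "\<delta> / 2 \<le> distr_fun (\<lambda>x. u K x - g x) \<epsilon>" by simp
    then have "ennreal (\<epsilon> * \<eta>) \<le> N (\<lambda>x. u K x - g x)"
      using \<epsilon> by (intro \<eta> in_space_diff u g) auto
    then show False using K by simp
  qed
  have "AE x in M01. \<bar>f x - g x\<bar> \<le> inverse (real (Suc i))" for i
  proof -
    have "{x \<in> {0..1}. inverse (real (Suc i)) < \<bar>f x - g x\<bar>} \<in> null_sets M01"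
      using zero[of "inverse (real (Suc i)) / 2"]
        level_set_measurable[of "\<lambda>x. f x - g x"]
      by (auto simp: distr_fun_def null_sets_def M01.emeasure_eq_measure)
    then have "AE x in M01. x \<notin> {x \<in> {0..1}. inverse (real (Suc i)) < \<bar>f x - g x\<bar>}"
      by (rule AE_not_in)
    then show ?thesis using AE_space by eventually_elim auto
  qed
  then have "AE x in M01. \<forall>i. \<bar>f x - g x\<bar> \<le> inverse (real (Suc i))"
    by (simp add: AE_all_countable)
  then show ?thesis
  proof eventually_elim
    case (elim x)
    show ?case
    proof (rule ccontr)
      assume "f x \<noteq> g x"
      then obtain i where "inverse (real (Suc i)) < \<bar>f x - g x\<bar>"
        using reals_Archimedean[of "\<bar>f x - g x\<bar>"] by auto
      then show False using elim by (meson not_less)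
    qed
  qed
qed

end

subsection \<open>Walsh series in rearrangement invariant spaces\<close>

text \<open>The partial sums are eventually constant. The support is an arbitrary finite set, not an
  initial segment, because coefficients are later placed along a subsequence.\<close>

lemma is_L2_sum_finite_support:
  assumes "finite I" "\<And>k. k \<notin> I \<Longrightarrow> a k = 0"
  shows "is_L2_sum a n (\<lambda>x. \<Sum>k\<in>I. a k * walsh (n k) x)"
    "summable (\<lambda>k. (a k)\<^sup>2)" "(\<Sum>k. (a k)\<^sup>2) = (\<Sum>k\<in>I. (a k)\<^sup>2)"
proof -
  have a2: "(a k)\<^sup>2 = 0" if "k \<notin> I" for k using assms(2)[OF that] by simp
  show "summable (\<lambda>k. (a k)\<^sup>2)" using assms(1) a2 by (rule summable_finite)
  show "(\<Sum>k. (a k)\<^sup>2) = (\<Sum>k\<in>I. (a k)\<^sup>2)" using assms(1) a2 by (rule suminf_finite)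
  obtain L where L: "\<And>k. k \<in> I \<Longrightarrow> k < L"
    using finite_nat_bounded[OF assms(1)] by blast
  have "(\<Sum>k\<in>I. a k * walsh (n k) x) = (\<Sum>k<K. a k * walsh (n k) x)" if "L \<le> K" for K x
    using L assms that by (intro sum.mono_neutral_left) (auto intro: less_le_trans)
  then have "eventually (\<lambda>K. (\<integral>\<^sup>+ x. ennreal (((\<Sum>k\<in>I. a k * walsh (n k) x)
      - (\<Sum>k<K. a k * walsh (n k) x))\<^sup>2) \<partial>M01) = 0) sequentially"
    by (intro eventually_sequentiallyI[of L]) simp
  then have "(\<lambda>K. \<integral>\<^sup>+ x. ennreal (((\<Sum>k\<in>I. a k * walsh (n k) x)
      - (\<Sum>k<K. a k * walsh (n k) x))\<^sup>2) \<partial>M01) \<longlonglongrightarrow> 0"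
    by (rule tendsto_eventually)
  then show "is_L2_sum a n (\<lambda>x. \<Sum>k\<in>I. a k * walsh (n k) x)"
    unfolding is_L2_sum_def by auto
qed

text \<open>A repeated index gives nonzero coefficients with vanishing sum, which the lower estimate
  in (iii) forbids; so the indices are pairwise distinct.\<close>

lemma not_inj_is_L2_sum_zero:
  assumes "i \<noteq> j" "n i = n j"
  shows "is_L2_sum (\<lambda>k. if k = i then 1 else if k = j then -1 else 0) n (\<lambda>_. 0)"
proof -
  let ?a = "\<lambda>k. if k = i then 1 else if k = j then -1 else 0 :: real"
  have "is_L2_sum ?a n (\<lambda>x. \<Sum>k\<in>{i, j}. ?a k * walsh (n k) x)"
    by (rule is_L2_sum_finite_support(1)) auto
  then show ?thesis using assms by simp
qed

text \<open>Infinitely many distinct indices are unbounded, so after \<open>n k\<close> one can pick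
  an index of at least \<open>2 ^ n k\<close>, a power of two exceeding \<open>n k\<close>. As n
  need not be monotone, g is merely injective, which suffices for transplanting
  coefficients.\<close>

lemma inj_dyadic_separated_subsequence:
  fixes n :: "nat \<Rightarrow> nat"
  assumes "inj n"
  obtains g where "inj g" "dyadic_separated (\<lambda>i. n (g i))"
proof -
  have unb: "\<exists>k. b \<le> n k" for b
  proof (rule ccontr)
    assume "\<nexists>k. b \<le> n k"
    then have "range n \<subseteq> {..<b}" by (auto simp: not_le)
    then have "finite (range n)" by (rule finite_subset) simp
    then show False using assms finite_imageD by blast
  qed
  have "\<exists>g. \<forall>i. 0 < n (g i) \<and> (\<exists>t. n (g i) < 2 ^ t \<and> 2 ^ t \<le> n (g (Suc i)))"
  proof (rule dependent_nat_choice)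
    show "\<exists>k. 0 < n k" using unb[of 1] by (auto simp: Suc_le_eq)
    fix k
    obtain k' where "2 ^ n k \<le> n k'" using unb by blast
    moreover have "n k < 2 ^ n k" by (rule less_exp)
    ultimately show "\<exists>k'. 0 < n k' \<and> (\<exists>t. n k < 2 ^ t \<and> 2 ^ t \<le> n k')"
      by (metis less_le_trans zero_less_numeral zero_less_power)
  qed
  then obtain g where g: "\<And>i. 0 < n (g i)" "\<And>i. \<exists>t. n (g i) < 2 ^ t \<and> 2 ^ t \<le> n (g (Suc i))"
    by blast
  have "n (g i) < n (g (Suc i))" for i using g(2)[of i] by (auto intro: less_le_trans)
  then have "inj (\<lambda>i. n (g i))" by (simp add: strict_mono_Suc_iff strict_mono_imp_inj_on)
  then have "inj g" by (auto simp: inj_on_def)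
  then show ?thesis using that g by (auto simp: dyadic_separated_def)
qed

text \<open>Chebyshev gives \<open>(exp (s^2) - 1) * p <= 1\<close> for the measure p of the level
  set; adding \<open>p <= 1\<close> turns this into a bound that is Gaussian down to s = 0.\<close>

lemma orlicz_tail:
  assumes f: "f \<in> borel_measurable M01" and c: "0 < c"
    and int: "(\<integral>\<^sup>+ x. ennreal (exp ((\<bar>f x\<bar> / c)\<^sup>2) - 1) \<partial>M01) \<le> 1" and s: "0 \<le> s"
  shows "distr_fun f (c * s) \<le> 2 * exp (- s\<^sup>2)"
proof -
  define A where "A = {x \<in> {0..1}. c * s < \<bar>f x\<bar>}"
  have A: "A \<in> sets M01" unfolding A_def by (rule level_set_measurable[OF f])
  have p: "measure M01 A \<le> 1" using M01.bounded_measure by simp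
  have "ennreal (exp (s\<^sup>2) - 1) * emeasure M01 A = (\<integral>\<^sup>+ x. ennreal (exp (s\<^sup>2) - 1) * indicator A x \<partial>M01)"
    using A by (simp add: nn_integral_cmult_indicator)
  also have "\<dots> \<le> (\<integral>\<^sup>+ x. ennreal (exp ((\<bar>f x\<bar> / c)\<^sup>2) - 1) \<partial>M01)"
  proof (rule nn_integral_mono)
    fix x
    show "ennreal (exp (s\<^sup>2) - 1) * indicator A x \<le> ennreal (exp ((\<bar>f x\<bar> / c)\<^sup>2) - 1)"
    proof (cases "x \<in> A")
      case True
      then have "s \<le> \<bar>f x\<bar> / c" using c by (simp add: A_def le_divide_eq mult.commute)
      then have "s\<^sup>2 \<le> (\<bar>f x\<bar> / c)\<^sup>2" using s by (intro power_mono)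
      then show ?thesis using True by (simp add: ennreal_leI)
    qed simp
  qed
  also note int
  finally have "ennreal ((exp (s\<^sup>2) - 1) * measure M01 A) \<le> ennreal 1"
    by (simp add: M01.emeasure_eq_measure ennreal_mult)
  then have "(exp (s\<^sup>2) - 1) * measure M01 A \<le> 1"
    by (subst (asm) ennreal_le_iff) auto
  then have "exp (s\<^sup>2) * measure M01 A \<le> 2" using p by (simp add: algebra_simps)
  then show ?thesis by (simp add: distr_fun_def A_def exp_minus field_simps)
qed

text \<open>The infimum of an empty set of reals carries no information, so an admissible constant
  must exist. With c above twice the essential bound the integrand is at most
  \<open>exp (1/4) - 1\<close>.\<close>

lemma orlicz_set_nonempty:
  assumes "ess_bounded f"
  shows "\<exists>c>0. (\<integral>\<^sup>+ x. ennreal (exp ((\<bar>f x\<bar> / c)\<^sup>2) - 1) \<partial>M01) \<le> 1"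
proof -
  obtain B where B: "AE x in M01. \<bar>f x\<bar> \<le> B" using assms by (auto simp: ess_bounded_def)
  define c where "c = 2 * \<bar>B\<bar> + 1"
  have c: "c > 0" by (simp add: c_def)
  have "AE x in M01. ennreal (exp ((\<bar>f x\<bar> / c)\<^sup>2) - 1) \<le> 1"
    using B
  proof eventually_elim
    case (elim x)
    have "\<bar>f x\<bar> / c \<le> 1 / 2" using elim c by (simp add: divide_le_eq c_def)
    then have "(\<bar>f x\<bar> / c)\<^sup>2 \<le> (1 / 2)\<^sup>2" using c by (intro power_mono) auto
    then have "exp ((\<bar>f x\<bar> / c)\<^sup>2) \<le> exp ((1 / 2)\<^sup>2)" by simp
    also have "exp ((1 / 2)\<^sup>2 :: real) \<le> 2"
      using exp_bound[of "(1 / 2)\<^sup>2 :: real"] by (simp add: power2_eq_square)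
    finally show ?case by (simp add: ennreal_le_1)
  qed
  then have "(\<integral>\<^sup>+ x. ennreal (exp ((\<bar>f x\<bar> / c)\<^sup>2) - 1) \<partial>M01) \<le> (\<integral>\<^sup>+ x. 1 \<partial>M01)"
    by (rule nn_integral_mono_AE)
  also have "\<dots> = 1" by (simp add: emeasure_M01[OF sets.top[of M01, simplified]])
  finally show ?thesis using c by blast
qed

section \<open>Implications between the embedding and the Walsh estimates\<close>

context
  fixes N :: "(real \<Rightarrow> real) \<Rightarrow> ennreal"
  assumes ri: "ri_space N"
begin

text \<open>The upper estimate, applied to differences of partial sums, makes these Cauchy in X.
  Completeness provides a limit in X, which is the L^2-sum by
  \<open>N_limit_eq_L2_limit\<close>.\<close>

lemma L2_sum_norm_bounds:
  assumes A: "0 < A" and B: "0 < B"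
    and fin: "\<And>a K. ennreal (A * sqrt (\<Sum>k<K. (a k)\<^sup>2)) \<le> N (\<lambda>x. \<Sum>k<K. a k * walsh (n k) x)
      \<and> N (\<lambda>x. \<Sum>k<K. a k * walsh (n k) x) \<le> ennreal (B * sqrt (\<Sum>k<K. (a k)\<^sup>2))"
    and a: "summable (\<lambda>k. (a k)\<^sup>2)" and f: "is_L2_sum a n f"
  shows "ennreal (A * sqrt (\<Sum>k. (a k)\<^sup>2)) \<le> N f \<and> N f \<le> ennreal (B * sqrt (\<Sum>k. (a k)\<^sup>2))"
proof -
  define S where "S K x = (\<Sum>k<K. a k * walsh (n k) x)" for K x
  define s where "s = (\<Sum>k. (a k)\<^sup>2)"
  define t where "t K = (\<Sum>k<K. (a k)\<^sup>2)" for K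
  have t: "t \<longlonglongrightarrow> s" unfolding t_def s_def using a by (rule summable_LIMSEQ)
  have t_le: "t K \<le> s" for K unfolding t_def s_def using a by (intro sum_le_suminf) auto
  have in_fin: "in_space N (\<lambda>x. \<Sum>k<K. b k * walsh (n k) x)" for b K
    using fin[of b K] by (intro in_spaceI) auto
  have S_in: "in_space N (S K)" for K unfolding S_def by (rule in_fin)
  have cauchy: "N (\<lambda>x. S i x - S j x) \<le> ennreal (B * sqrt (s - t K))" if "K \<le> i" "K \<le> j" for i j K
  proof -
    \<comment> \<open>Thus b vanishes below K and its square never exceeds that of a, so the
      difference is again a finite Walsh sum, controlled by the tail of the series.\<close>
    define b where "b k = (if k < i then a k else 0) - (if k < j then a k else 0)" for k
    define M where "M = max i j"
    have expand: "S i x = (\<Sum>k<M. (if k < i then a k else 0) * walsh (n k) x)" if "i \<le> M" for i x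
      unfolding S_def using that by (intro sum.mono_neutral_cong_left) auto
    have "S i x - S j x = (\<Sum>k<M. b k * walsh (n k) x)" for x
      by (simp add: expand M_def b_def left_diff_distrib sum_subtractf)
    then have "N (\<lambda>x. S i x - S j x) \<le> ennreal (B * sqrt (\<Sum>k<M. (b k)\<^sup>2))"
      using fin[of b M] by simp
    also have "\<dots> \<le> ennreal (B * sqrt (s - t K))"
    proof -
      have "(\<Sum>k<M. (b k)\<^sup>2) \<le> (\<Sum>k\<in>{K..<M}. (a k)\<^sup>2)"
      proof -
        have "(\<Sum>k<M. (b k)\<^sup>2) = (\<Sum>k\<in>{K..<M}. (b k)\<^sup>2)"
          using that by (intro sum.mono_neutral_right) (auto simp: b_def)
        also have "\<dots> \<le> (\<Sum>k\<in>{K..<M}. (a k)\<^sup>2)"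
          by (intro sum_mono) (auto simp: b_def)
        finally show ?thesis .
      qed
      also have "\<dots> = t M - t K"
        using that sum_diff_nat_ivl[of 0 K M "\<lambda>k. (a k)\<^sup>2"] by (simp add: t_def M_def atLeast0LessThan)
      also have "\<dots> \<le> s - t K" using t_le by simp
      finally show ?thesis using B by (intro ennreal_leI mult_left_mono) auto
    qed
    finally show ?thesis .
  qed
  have tail: "(\<lambda>K. ennreal (B * sqrt (s - t K))) \<longlonglongrightarrow> 0"
  proof -
    have "(\<lambda>K. ennreal (B * sqrt (s - t K))) \<longlonglongrightarrow> ennreal (B * sqrt (s - s))"
      by (intro tendsto_intros t)
    then show ?thesis by simp
  qed
  obtain g where g: "in_space N g" "(\<lambda>K. N (\<lambda>x. S K x - g x)) \<longlonglongrightarrow> 0"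
  proof (rule N_complete[OF ri S_in])
    fix e :: ennreal assume "e > 0"
    then have "eventually (\<lambda>K. ennreal (B * sqrt (s - t K)) < e) sequentially"
      by (intro order_tendstoD[OF tail])
    then obtain K where "ennreal (B * sqrt (s - t K)) < e" by (auto simp: eventually_sequentially)
    then show "\<exists>K. \<forall>m\<ge>K. \<forall>n\<ge>K. N (\<lambda>x. S m x - S n x) < e"
      using cauchy by (meson le_less_trans)
  qed blast
  have fm: "f \<in> borel_measurable M01" using f by (simp add: is_L2_sum_def)
  have "AE x in M01. f x = g x"
    using f by (intro N_limit_eq_L2_limit[OF ri S_in g(1) fm g(2)]) (simp add: is_L2_sum_def S_def)
  then have Nfg: "N f = N g" by (rule N_cong_AE[OF ri fm in_space_measurable[OF g(1)]])
  \<comment> \<open>The estimates reach the limit through the triangle inequality, with an error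
    that tends to 0.\<close>
  have "ennreal (A * sqrt (t K)) \<le> N g + N (\<lambda>x. S K x - g x)" for K
  proof -
    have "ennreal (A * sqrt (t K)) \<le> N (S K)" using fin[of a K] by (simp add: t_def S_def[abs_def])
    also have "\<dots> \<le> N g + N (\<lambda>x. S K x - g x)"
      using N_triangle[OF ri g(1) in_space_diff[OF ri S_in[of K] g(1)]] by simp
    finally show ?thesis .
  qed
  moreover have "(\<lambda>K. ennreal (A * sqrt (t K))) \<longlonglongrightarrow> ennreal (A * sqrt s)"
    by (intro tendsto_intros t)
  moreover have "(\<lambda>K. N g + N (\<lambda>x. S K x - g x)) \<longlonglongrightarrow> N g + 0"
    by (intro tendsto_add tendsto_const g)
  ultimately have lower: "ennreal (A * sqrt s) \<le> N g"
    using LIMSEQ_le[of "\<lambda>K. ennreal (A * sqrt (t K))"] by fastforce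
  have "N g \<le> ennreal (B * sqrt s) + N (\<lambda>x. S K x - g x)" for K
  proof -
    have "N g \<le> N (S K) + N (\<lambda>x. g x - S K x)"
      using N_triangle[OF ri S_in in_space_diff[OF ri g(1) S_in[of K]], of K] by simp
    also have "N (\<lambda>x. g x - S K x) = N (\<lambda>x. S K x - g x)" by (rule N_minus_commute[OF ri g(1) S_in])
    also have "N (S K) \<le> ennreal (B * sqrt (t K))" using fin[of a K] by (simp add: t_def S_def[abs_def])
    also have "\<dots> \<le> ennreal (B * sqrt s)" using B t_le by (intro ennreal_leI mult_left_mono) auto
    finally show ?thesis by (simp add: add_right_mono)
  qed
  moreover have "(\<lambda>K. ennreal (B * sqrt s) + N (\<lambda>x. S K x - g x)) \<longlonglongrightarrow> ennreal (B * sqrt s) + 0"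
    by (intro tendsto_add tendsto_const g)
  ultimately have "N g \<le> ennreal (B * sqrt s)"
    using LIMSEQ_le_const[of "\<lambda>K. ennreal (B * sqrt s) + N (\<lambda>x. S K x - g x)"] by auto
  then show ?thesis using lower Nfg by (simp add: s_def)
qed

lemma embedding_imp_lacunary:
  assumes C: "0 < C" "\<And>f. ess_bounded f \<Longrightarrow> N f \<le> ennreal (C * orlicz_M2_norm f)" and q: "q > 1"
  shows "\<exists>A>0. \<exists>B>0. \<forall>n a f. lacunary q n \<longrightarrow> summable (\<lambda>k. (a k)\<^sup>2) \<longrightarrow> is_L2_sum a n f \<longrightarrow>
    ennreal (A * sqrt (\<Sum>k. (a k)\<^sup>2)) \<le> N f \<and> N f \<le> ennreal (B * sqrt (\<Sum>k. (a k)\<^sup>2))"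
proof -
  obtain \<rho> where \<rho>: "0 < \<rho>" "\<And>n a K. lacunary q n \<Longrightarrow>
    subgaussian (\<rho> * sqrt (\<Sum>k<K. (a k)\<^sup>2)) (\<lambda>x. \<Sum>k<K. a k * walsh (n k) x)"
    using lacunary_subgaussian[OF q] by blast
  obtain \<delta> where \<delta>: "0 < \<delta>" "\<And>n a K. lacunary q n \<Longrightarrow> 0 < (\<Sum>k<K. (a k)\<^sup>2) \<Longrightarrow>
    \<delta> \<le> measure M01 {x \<in> {0..1}. sqrt (\<Sum>k<K. (a k)\<^sup>2) / 2 < \<bar>\<Sum>k<K. a k * walsh (n k) x\<bar>}"
    using lacunary_large_set[OF q] by blast
  obtain \<eta> where \<eta>: "0 < \<eta>"
    "\<And>h \<epsilon>. in_space N h \<Longrightarrow> 0 \<le> \<epsilon> \<Longrightarrow> \<delta> \<le> distr_fun h \<epsilon> \<Longrightarrow> ennreal (\<epsilon> * \<eta>) \<le> N h"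
    using N_weak_type[OF ri \<delta>(1)] by blast
  \<comment> \<open>\<open>\<eta>\<close> belongs to sets of measure \<open>\<delta>\<close>, on
    which the sum exceeds half its l^2-norm, hence the 1/2. B is the embedding constant times the
    Orlicz bound of a subgaussian sum.\<close>
  define A where "A = \<eta> / 2"
  define B where "B = C * (sqrt (2 * exp 1) * \<rho>)"
  have AB: "0 < A" "0 < B" using C \<rho> \<eta> by (auto simp: A_def B_def)
  have "ennreal (A * sqrt (\<Sum>k<K. (a k)\<^sup>2)) \<le> N (\<lambda>x. \<Sum>k<K. a k * walsh (n k) x)
      \<and> N (\<lambda>x. \<Sum>k<K. a k * walsh (n k) x) \<le> ennreal (B * sqrt (\<Sum>k<K. (a k)\<^sup>2))"
    if n: "lacunary q n" for n a K
  proof (cases "(\<Sum>k<K. (a k)\<^sup>2) = 0")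
    case True
    then have "\<forall>k<K. a k = 0" by (simp add: sum_nonneg_eq_0_iff)
    then show ?thesis using N_zero[OF ri] True by simp
  next
    case False
    define s where "s = (\<Sum>k<K. (a k)\<^sup>2)"
    define S where "S x = (\<Sum>k<K. a k * walsh (n k) x)" for x
    have s: "0 < s" using False unfolding s_def by (simp add: sum_nonneg order.not_eq_order_implies_strict)
    have sub: "subgaussian (\<rho> * sqrt s) S" unfolding s_def S_def using \<rho>(2)[OF n] .
    then have bd: "ess_bounded S" by (simp add: subgaussian_def)
    have pos: "0 < sqrt (2 * exp 1) * (\<rho> * sqrt s)" using \<rho> s by simp
    have "orlicz_M2_norm S \<le> sqrt (2 * exp 1) * (\<rho> * sqrt s)"
      unfolding orlicz_M2_norm_def
      using subgaussian_orlicz[OF sub] pos \<rho> s by (intro cInf_lower bdd_belowI[of _ 0]) auto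
    then have "C * orlicz_M2_norm S \<le> B * sqrt s"
      using C by (simp add: B_def mult.assoc)
    then have upper: "N S \<le> ennreal (B * sqrt s)" using C(2)[OF bd] by (meson ennreal_leI order_trans)
    \<comment> \<open>The upper estimate comes before the lower one because the weak-type bound
      applies only to members of X.\<close>
    then have "in_space N S" by (rule in_spaceI[OF ess_boundedD[OF bd]])
    then have "ennreal (sqrt s / 2 * \<eta>) \<le> N S"
      using \<delta>(2)[OF n, of a K] s by (intro \<eta>) (auto simp: distr_fun_def s_def S_def)
    then show ?thesis using upper by (simp add: A_def s_def S_def[abs_def] mult.commute)
  qed
  then show ?thesis
    using AB by (intro exI[of _ A] conjI exI[of _ B] allI impI L2_sum_norm_bounds) auto
qed

text \<open>At level \<open>12 * s\<close> an admissible f has tail at most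
  \<open>2 * exp (-144 * s^2)\<close>, against \<open>exp (-128 * s^2) / 4\<close> for the Walsh
  sums; 12 is the least integer whose square exceeds 128. The tails compare for
  \<open>s >= 3/8\<close>, hence the cutoff \<open>9/2 = 12 * 3/8\<close>. The total 12 + 9/2 is
  rounded up to 24.\<close>

lemma walsh_sum_imp_embedding:
  assumes A: "0 < A" and B: "0 < B"
    and iii: "\<And>a f. summable (\<lambda>k. (a k)\<^sup>2) \<Longrightarrow> is_L2_sum a n f \<Longrightarrow>
      ennreal (A * sqrt (\<Sum>k. (a k)\<^sup>2)) \<le> N f \<and> N f \<le> ennreal (B * sqrt (\<Sum>k. (a k)\<^sup>2))"
    and f: "ess_bounded f"
  shows "N f \<le> ennreal (24 * B * orlicz_M2_norm f)"
proof -
  have "inj n"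
  proof (rule injI, rule ccontr)
    fix i j assume ij: "n i = n j" "i \<noteq> j"
    let ?a = "\<lambda>k. if k = i then 1 else if k = j then -1 else 0 :: real"
    have sup: "k \<notin> {i, j} \<Longrightarrow> ?a k = 0" for k by auto
    have "ennreal (A * sqrt (\<Sum>k. (?a k)\<^sup>2)) \<le> N (\<lambda>_. 0)"
      using iii[OF is_L2_sum_finite_support(2)[of "{i, j}" ?a, OF _ sup] not_inj_is_L2_sum_zero[OF ij(2,1)]]
      by simp
    moreover have "(\<Sum>k. (?a k)\<^sup>2) = 2"
      using is_L2_sum_finite_support(3)[of "{i, j}" ?a, OF _ sup] ij by simp
    ultimately show False using A N_zero[OF ri] by (simp add: ennreal_eq_0_iff mult_le_0_iff)
  qed
  then obtain g where g: "inj g" "dyadic_separated (\<lambda>i. n (g i))"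
    using inj_dyadic_separated_subsequence by blast
  define R where "R L x = (\<Sum>i<L. 1 / sqrt (real L) * walsh (n (g i)) x)" for L x
  have R_bd: "ess_bounded (R L)" for L
    unfolding R_def by (auto intro!: ess_bounded_intros simp: divide_inverse)
  have NR: "N (R L) \<le> ennreal B" if L: "0 < L" for L
  proof -
    define a where "a k = (if k \<in> g ` {..<L} then 1 / sqrt (real L) else 0)" for k
    have sup: "a k = 0" if "k \<notin> g ` {..<L}" for k using that by (simp add: a_def)
    have inj: "inj_on g {..<L}" using g(1) inj_on_subset by blast
    have "(\<Sum>k\<in>g ` {..<L}. a k * walsh (n k) x) = R L x" for x
      using inj by (simp add: R_def a_def sum.reindex)
    moreover have "(\<Sum>k. (a k)\<^sup>2) = 1"
      using is_L2_sum_finite_support(3)[of "g ` {..<L}" a, OF _ sup] inj L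
      by (simp add: a_def card_image power_divide)
    ultimately show ?thesis
      using iii[OF is_L2_sum_finite_support(2,1)[of "g ` {..<L}" a, OF _ sup]] by simp
  qed
  then have R_in: "in_space N (R L)" if "0 < L" for L
    using that ess_boundedD[OF R_bd] by (intro in_spaceI)
  \<comment> \<open>The constant function need not belong to the subsystem, but \<open>R 1\<close>
    is a single Walsh function and has modulus 1 a.e.\<close>
  have one: "N (\<lambda>_. 1) \<le> ennreal B"
  proof -
    have "N (\<lambda>_. 1) \<le> N (R 1)"
    proof (rule N_mono[OF ri R_in])
      show "AE x in M01. \<bar>1\<bar> \<le> \<bar>R 1 x\<bar>"
        using AE_walsh_pm1 by eventually_elim (auto simp: R_def dest: spec[of _ "n (g 0)"])
    qed auto
    then show ?thesis using NR[of 1] by simp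
  qed
  have one_in: "in_space N (\<lambda>_. 1)" using one by (intro in_spaceI[where N = N]) auto
  have key: "N f \<le> ennreal (24 * B * c)"
    if c: "0 < c" and int: "(\<integral>\<^sup>+ x. ennreal (exp ((\<bar>f x\<bar> / c)\<^sup>2) - 1) \<partial>M01) \<le> 1" for c
  proof -
    note fm = ess_boundedD[OF f]
    obtain b where b: "AE x in M01. \<bar>f x\<bar> \<le> b" using f by (auto simp: ess_bounded_def)
    \<comment> \<open>Then \<open>32 * s^2 <= L\<close> for every nonnegative level s up to
      \<open>|b| / (12 * c)\<close>, beyond which f has no tail; the summand 8 makes L
      positive.\<close>
    obtain L :: nat where L: "32 * (\<bar>b\<bar> / (12 * c))\<^sup>2 + 8 \<le> real L" using real_arch_simple by blast
    have "0 \<le> 32 * (\<bar>b\<bar> / (12 * c))\<^sup>2" by simp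
    then have "0 < real L" using L by linarith
    then have L0: "0 < L" by simp
    define h where "h x = (if 9 / 2 * c < \<bar>f x\<bar> then f x / (12 * c) else 0)" for x
    define k where "k x = (if 9 / 2 * c < \<bar>f x\<bar> then 0 else f x)" for x
    have hm: "h \<in> borel_measurable M01" "k \<in> borel_measurable M01"
      unfolding h_def k_def using fm by measurable
    have h_bd: "ess_bounded h"
    proof (rule ess_boundedI[OF hm(1)])
      show "AE x in M01. \<bar>h x\<bar> \<le> \<bar>b\<bar> / (12 * c)"
        using b by eventually_elim (use c in \<open>auto simp: h_def divide_right_mono\<close>)
    qed
    \<comment> \<open>A nonzero value of h has modulus above 3/8, so its distribution function is
      constant on \<open>{0..3/8}\<close>; this accounts for the maximum.\<close>
    have level: "distr_fun h s = distr_fun f (c * (12 * max s (3 / 8)))" if "0 \<le> s" for s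
    proof -
      have "s < \<bar>h x\<bar> \<longleftrightarrow> c * (12 * max s (3 / 8)) < \<bar>f x\<bar>" for x
      proof -
        have cut: "s < (if q < y then z else 0) \<longleftrightarrow> (if b then q else p) < y"
          if "s < z \<longleftrightarrow> p < y" "b \<Longrightarrow> p \<le> q" "\<not> b \<Longrightarrow> q \<le> p" for p q y z :: real and b
          using that \<open>0 \<le> s\<close> by (cases b; cases "q < y") auto
        have "s < (if 9 / 2 * c < \<bar>f x\<bar> then \<bar>f x\<bar> / (12 * c) else 0) \<longleftrightarrow>
            (if s \<le> 3 / 8 then 9 / 2 * c else c * (12 * s)) < \<bar>f x\<bar>"
        proof (rule cut)
          show "s < \<bar>f x\<bar> / (12 * c) \<longleftrightarrow> c * (12 * s) < \<bar>f x\<bar>"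
            using c by (simp add: less_divide_eq mult_ac)
          show "c * (12 * s) \<le> 9 / 2 * c" if "s \<le> 3 / 8"
            using mult_left_mono[OF that, of "12 * c"] c by (simp add: mult_ac)
          show "9 / 2 * c \<le> c * (12 * s)" if "\<not> s \<le> 3 / 8"
            using mult_left_mono[of "3 / 8" s "12 * c"] that c by (simp add: mult_ac)
        qed
        moreover have "\<bar>h x\<bar> = (if 9 / 2 * c < \<bar>f x\<bar> then \<bar>f x\<bar> / (12 * c) else 0)"
          using c by (simp add: h_def)
        moreover have "c * (12 * max s (3 / 8)) = (if s \<le> 3 / 8 then 9 / 2 * c else c * (12 * s))"
          by (simp add: max_def)
        ultimately show ?thesis by (simp only:)
      qed
      then show ?thesis by (simp add: distr_fun_def)
    qed
    have tailR: "distr_fun f (c * (12 * s)) \<le> distr_fun (R L) s" if s: "3 / 8 \<le> s" for s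
    proof (cases "32 * s\<^sup>2 \<le> real L")
      case True
      have "distr_fun f (c * (12 * s)) \<le> 2 * exp (- (12 * s)\<^sup>2)"
        using s by (intro orlicz_tail[OF fm c int]) simp
      \<comment> \<open>The spare exponent is 144 - 128 = 16, and \<open>16 * (3/8)^2 = 9/4\<close>
        with \<open>exp (9/4) >= 8\<close> absorbs the two constants 2 and 1/4.\<close>
      also have "\<dots> \<le> exp (- (128 * s\<^sup>2)) / 4"
      proof -
        have "(3 / 8)\<^sup>2 \<le> s\<^sup>2" using s by (intro power_mono) auto
        then have "9 / 4 \<le> 16 * s\<^sup>2" by (simp add: power2_eq_square)
        have "(8::real) \<le> exp (9 / 4)"
        proof -
          have "(2::real) \<le> exp (3 / 4)"
            using exp_lower_Taylor_quadratic[of "3 / 4 :: real"] by (simp add: power2_eq_square)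
          then have "(2::real) ^ 3 \<le> exp (3 / 4) ^ 3" by (rule power_mono) simp
          also have "\<dots> = exp (9 / 4)" by (simp flip: exp_of_nat_mult)
          finally show ?thesis by simp
        qed
        also have "\<dots> \<le> exp (16 * s\<^sup>2)" using \<open>9 / 4 \<le> 16 * s\<^sup>2\<close> by simp
        finally have "8 * exp (- (144 * s\<^sup>2)) \<le> exp (16 * s\<^sup>2) * exp (- (144 * s\<^sup>2))"
          by (rule mult_right_mono) simp
        also have "\<dots> = exp (- (128 * s\<^sup>2))" by (simp flip: exp_add)
        finally show ?thesis by (simp add: power_mult_distrib)
      qed
      also have "\<dots> \<le> measure M01 {x \<in> {0..1}. s < R L x}"
        unfolding R_def by (rule dyadic_separated_lower_tail[OF g(2) s True])
      also have "\<dots> \<le> distr_fun (R L) s"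
        unfolding distr_fun_def
        by (intro M01.finite_measure_mono level_set_measurable ess_boundedD[OF R_bd]) auto
      finally show ?thesis .
    next
      case False
      \<comment> \<open>Outside the range of the lower tail estimate the level exceeds the essential
        bound of f, so the left side is 0.\<close>
      then have "(\<bar>b\<bar> / (12 * c))\<^sup>2 < s\<^sup>2" using L by linarith
      then have "\<bar>b\<bar> / (12 * c) < s" by (rule power_less_imp_less_base) (use s in simp)
      then have lt: "\<bar>b\<bar> < c * (12 * s)" using c by (simp add: divide_less_eq mult_ac)
      have "AE x in M01. \<not> c * (12 * s) < \<bar>f x\<bar>" using b by eventually_elim (use lt in auto)
      then have "distr_fun f (c * (12 * s)) = 0"
        unfolding distr_fun_def
        using level_set_measurable[OF fm, of "c * (12 * s)"]
          AE_iff_null[of M01 "\<lambda>x. \<not> c * (12 * s) < \<bar>f x\<bar>"]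
        by (simp only: not_not space_M01 measure_eq_0_null_sets)
      then show ?thesis by (simp add: distr_fun_def)
    qed
    have "N h \<le> N (R L)"
    proof (rule N_mono_distr[OF ri h_bd R_bd R_in[OF L0]])
      fix s :: real assume s: "0 \<le> s"
      have "distr_fun h s \<le> distr_fun (R L) (max s (3 / 8))" using tailR level[OF s] by simp
      also have "\<dots> \<le> distr_fun (R L) s" by (intro distr_fun_antimono ess_boundedD[OF R_bd]) simp
      finally show "distr_fun h s \<le> distr_fun (R L) s" .
    qed
    then have Nh: "N h \<le> ennreal B" using NR[OF L0] by simp
    then have h_in: "in_space N h" by (rule in_spaceI[OF hm(1)])
    have ch_in: "in_space N (\<lambda>x. (12 * c) * h x)" by (rule in_space_scale[OF ri h_in])
    have c1_in: "in_space N (\<lambda>x. (9 / 2 * c) * 1)" by (rule in_space_scale[OF ri one_in])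
    have Nk: "N k \<le> N (\<lambda>x. (9 / 2 * c) * 1)"
      using c by (intro N_mono[OF ri c1_in hm(2)] AE_I2) (auto simp: k_def)
    then have k_in: "in_space N k" using hm c1_in by (auto simp: in_space_def intro: le_less_trans)
    have "N f = N (\<lambda>x. (12 * c) * h x + k x)"
      using c by (intro arg_cong[where f = N]) (auto simp: h_def k_def)
    also have "\<dots> \<le> N (\<lambda>x. (12 * c) * h x) + N k" by (rule N_triangle[OF ri ch_in k_in])
    also have "\<dots> \<le> ennreal (12 * c) * ennreal B + ennreal (9 / 2 * c) * ennreal B"
    proof (rule add_mono)
      show "N (\<lambda>x. (12 * c) * h x) \<le> ennreal (12 * c) * ennreal B"
        unfolding N_scale[OF ri h_in] using c by (auto intro: mult_left_mono Nh)
      have "N k \<le> ennreal \<bar>9 / 2 * c\<bar> * N (\<lambda>_. 1)" using Nk unfolding N_scale[OF ri one_in] .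
      also have "\<dots> \<le> ennreal \<bar>9 / 2 * c\<bar> * ennreal B" by (intro mult_left_mono one) simp
      finally show "N k \<le> ennreal (9 / 2 * c) * ennreal B" using c by simp
    qed
    also have "\<dots> = ennreal (12 * c * B + 9 / 2 * c * B)"
    proof -
      have "ennreal (12 * c) * ennreal B = ennreal (12 * c * B)"
        "ennreal (9 / 2 * c) * ennreal B = ennreal (9 / 2 * c * B)"
        by (rule ennreal_mult[symmetric]; use c B in simp)+
      moreover have "ennreal (12 * c * B) + ennreal (9 / 2 * c * B) = ennreal (12 * c * B + 9 / 2 * c * B)"
        by (rule ennreal_plus[symmetric]; use c B in simp)
      ultimately show ?thesis by (simp only:)
    qed
    also have "\<dots> \<le> ennreal (24 * B * c)"
      using c B by (intro ennreal_leI) (simp add: algebra_simps)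
    finally show ?thesis .
  qed
  \<comment> \<open>The Orlicz norm may be 0 and not itself admissible, so the bound is passed from
    all admissible c to their infimum. One admissible constant first shows that \<open>N f\<close>
    is finite.\<close>
  let ?D = "{c. 0 < c \<and> (\<integral>\<^sup>+ x. ennreal (exp ((\<bar>f x\<bar> / c)\<^sup>2) - 1) \<partial>M01) \<le> 1}"
  obtain c0 where c0: "c0 \<in> ?D" using orlicz_set_nonempty[OF f] by blast
  have "in_space N f" using key c0 ess_boundedD[OF f] by (intro in_spaceI) auto
  then obtain y where y: "0 \<le> y" "N f = ennreal y" by (cases "N f") (auto simp: in_space_def)
  have "y / (24 * B) \<le> orlicz_M2_norm f"
    unfolding orlicz_M2_norm_def
  proof (rule cInf_greatest)
    show "?D \<noteq> {}" using c0 by blast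
    fix c assume "c \<in> ?D"
    then have "0 < c" "ennreal y \<le> ennreal (24 * B * c)" using key y by auto
    then have "y \<le> 24 * B * c" using B y by (subst (asm) ennreal_le_iff) auto
    then show "y / (24 * B) \<le> c" using B by (simp add: divide_le_eq mult_ac)
  qed
  then show ?thesis using B y by (auto intro!: ennreal_leI simp: divide_le_eq mult_ac)
qed

end

theorem theorem3p5:
  fixes N :: "(real \<Rightarrow> real) \<Rightarrow> ennreal"
  assumes "ri_space N"
  defines "cond_i \<equiv> (\<exists>C>0. \<forall>f. ess_bounded f \<longrightarrow> N f \<le> ennreal (C * orlicz_M2_norm f))"
    and "cond_ii \<equiv> (\<forall>q>1. \<exists>A>0. \<exists>B>0. \<forall>n a f. lacunary q n \<longrightarrow>
            summable (\<lambda>k. (a k)\<^sup>2) \<longrightarrow> is_L2_sum a n f \<longrightarrow>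
            ennreal (A * sqrt (\<Sum>k. (a k)\<^sup>2)) \<le> N f \<and>
            N f \<le> ennreal (B * sqrt (\<Sum>k. (a k)\<^sup>2)))"
    and "cond_iii \<equiv> (\<exists>n :: nat \<Rightarrow> nat. \<exists>A>0. \<exists>B>0. \<forall>a f.
            summable (\<lambda>k. (a k)\<^sup>2) \<longrightarrow> is_L2_sum a n f \<longrightarrow>
            ennreal (A * sqrt (\<Sum>k. (a k)\<^sup>2)) \<le> N f \<and>
            N f \<le> ennreal (B * sqrt (\<Sum>k. (a k)\<^sup>2)))"
  shows "(cond_i \<longleftrightarrow> cond_ii) \<and> (cond_ii \<longleftrightarrow> cond_iii)"
proof -
  have "cond_ii" if "cond_i"
    using that embedding_imp_lacunary[OF assms(1)] unfolding cond_i_def cond_ii_def by blast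
  moreover have "cond_iii" if ii: "cond_ii"
  proof -
    \<comment> \<open>The witness is the Rademacher system: \<open>walsh (2 ^ k)\<close> is
      \<open>rademacher (Suc k)\<close>.\<close>
    have "lacunary 2 (\<lambda>k. 2 ^ k)" by (simp add: lacunary_def)
    moreover have "(1::real) < 2" by simp
    ultimately show ?thesis
      using ii unfolding cond_ii_def cond_iii_def by (intro exI[of _ "\<lambda>k. 2 ^ k"]) metis
  qed
  moreover have "cond_i" if iii: "cond_iii"
  proof -
    obtain n A B where AB: "0 < A" "0 < B" "\<And>a f. summable (\<lambda>k. (a k)\<^sup>2) \<Longrightarrow> is_L2_sum a n f \<Longrightarrow>
        ennreal (A * sqrt (\<Sum>k. (a k)\<^sup>2)) \<le> N f \<and> N f \<le> ennreal (B * sqrt (\<Sum>k. (a k)\<^sup>2))"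
      using iii unfolding cond_iii_def by blast
    have "N f \<le> ennreal (24 * B * orlicz_M2_norm f)" if "ess_bounded f" for f
      using walsh_sum_imp_embedding[OF assms(1) AB that] by blast
    moreover have "0 < 24 * B" using AB by simp
    ultimately show ?thesis unfolding cond_i_def by blast
  qed
  ultimately show ?thesis by blast
qed

end
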